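(* Let $n\ge 1$, $T>0$, and suppose: $\ell:\mathbb{R}^n\to\mathbb{R}$ is $C^2$, strictly convex, and $\lim_{|u|\to\infty}\ell(u)/|u|=\infty$; $g:\mathbb{R}^n\to\mathbb{R}$ is globally Lipschitz; $d:[0,T]\times[0,T]\to(a,1]$, $(t,s)\mapsto d_t(s)$, with $a>0$, is Lipschitz continuous with $d_t(t)=1$ for each $t$. Suppose further that, for every $t\le s\le T$, $d_t(s)$ and $\frac{\partial}{\partial t}d_t(s)$ are continuous in $t$ and summable in $s$. Let $$v(x,t)=\inf_{y\in \mathrm{AC}_{x,t}}\left\{\int_t^T d_t(s)\,\ell(\dot y(s))\,ds+d_t(T)\,g(y(T))\right\}.$$ Let $(x,t)\in\mathbb{R}^n\times(0,T)$ be a point at which $v$ is differentiable, and let $\alpha(x,t)\in A(x,t)$. Then $$-v_t(x,t)+\ell^*(-v_x(x,t))+w(x,t,\alpha(x,t))=0.$$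
   Context: $\mathrm{AC}_{x,t}$ is the set of absolutely continuous $y:[t,T]\to\mathbb{R}^n$ with $y(t)=x$. $\ell^*(p)=\sup_{u\in\mathbb{R}^n}\{p\cdot u-\ell(u)\}$. $v_x$ is the gradient in $x$, $v_t$ the derivative in $t$. $\iota=(\nabla\ell)^{-1}$ is the inverse function of the bijection $\nabla\ell:\mathbb{R}^n\to\mathbb{R}^n$, and $d_t^{-1}(s)=1/d_t(s)$. For $x,\alpha\in\mathbb{R}^n$, $0\le t\le s\le T$: $$U_{t,\alpha}(s)=\iota(d_t^{-1}(s)\nabla\ell(\alpha)),\qquad Y_{t,x,\alpha}(s)=x+\int_t^s U_{t,\alpha}(r)\,dr,$$ $$V(x,t,\alpha)=\int_t^T d_t(s)\,\ell(U_{t,\alpha}(s))\,ds+d_t(T)\,g(Y_{t,x,\alpha}(T)),\qquad A(x,t)=\operatorname{argmin}_{\alpha\in\mathbb{R}^n}V(x,t,\alpha),$$ $$w(x,t,\alpha)=\int_t^T\frac{\partial d_t}{\partial t}(s)\,\ell(U_{t,\alpha}(s))\,ds+\frac{\partial d_t}{\partial t}(T)\,g(Y_{t,x,\alpha}(T)).$$ Only the values $d_t(s)$ with $t\le s$ enter. *)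

theory Defs
  imports "HOL-Analysis.Analysis"
begin

definition grad :: "('a::real_inner \<Rightarrow> real) \<Rightarrow> 'a \<Rightarrow> 'a" where
  "grad f x = (THE D. GDERIV f x :> D)"

definition C2 :: "('a::real_normed_vector \<Rightarrow> real) \<Rightarrow> bool" where
  "C2 f \<longleftrightarrow> (\<exists>(f' :: 'a \<Rightarrow> 'a \<Rightarrow>\<^sub>L real) (f'' :: 'a \<Rightarrow> 'a \<Rightarrow>\<^sub>L 'a \<Rightarrow>\<^sub>L real).
     (\<forall>x. (f has_derivative blinfun_apply (f' x)) (at x)) \<and>
     (\<forall>x. (f' has_derivative blinfun_apply (f'' x)) (at x)) \<and>
     continuous_on UNIV f'')"

definition strictly_convex :: "('a::real_vector \<Rightarrow> real) \<Rightarrow> bool" where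
  "strictly_convex f \<longleftrightarrow> (\<forall>x y. x \<noteq> y \<longrightarrow> (\<forall>\<theta>. 0 < \<theta> \<and> \<theta> < 1 \<longrightarrow>
     f ((1 - \<theta>) *\<^sub>R x + \<theta> *\<^sub>R y) < (1 - \<theta>) * f x + \<theta> * f y))"

text \<open>The supremum is taken in the reals; it is the usual Legendre transform when \<open>l\<close> is
  superlinear, which makes the set bounded above.\<close>

definition legendre :: "('a::real_inner \<Rightarrow> real) \<Rightarrow> 'a \<Rightarrow> real" where
  "legendre l p = (SUP u. p \<bullet> u - l u)"

text \<open>The usual \<open>\<epsilon>\<close>-\<open>\<delta>\<close> condition; a finite family of non-overlapping compact intervals in \<open>S\<close> is
  a set \<open>D\<close> that is a division of its own union.\<close>

definition abs_continuous_on :: "real set \<Rightarrow> (real \<Rightarrow> 'a::real_normed_vector) \<Rightarrow> bool" where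
  "abs_continuous_on S y \<longleftrightarrow> (\<forall>\<epsilon>>0. \<exists>\<delta>>0. \<forall>D.
     D division_of \<Union>D \<and> \<Union>D \<subseteq> S \<and> (\<Sum>K\<in>D. Sup K - Inf K) < \<delta> \<longrightarrow>
     (\<Sum>K\<in>D. norm (y (Sup K) - y (Inf K))) < \<epsilon>)"

definition AC :: "real \<Rightarrow> 'a::real_normed_vector \<Rightarrow> real \<Rightarrow> (real \<Rightarrow> 'a) set" where
  "AC T x t = {y. abs_continuous_on {t..T} y \<and> y t = x}"

text \<open>Throughout, \<open>d t s\<close> stands for \<open>d\<^sub>t(s)\<close>.

  For superlinear \<open>l\<close> and bounded positive \<open>d\<close> the running cost of an absolutely continuous curve
  is measurable and bounded below, so if it is not integrable, its integral is \<open>\<infinity>\<close>. (The Bochner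
  integral would be \<open>0\<close> there.) The derivative of \<open>y\<close> exists almost everywhere.\<close>

definition cost :: "real \<Rightarrow> (real \<Rightarrow> real \<Rightarrow> real) \<Rightarrow> ('a::euclidean_space \<Rightarrow> real) \<Rightarrow> ('a \<Rightarrow> real) \<Rightarrow>
    real \<Rightarrow> (real \<Rightarrow> 'a) \<Rightarrow> ereal" where
  "cost T d l g t y =
     (let r = (\<lambda>s. d t s * l (vector_derivative y (at s within {t..T}))) in
      if set_integrable lebesgue {t..T} r
      then ereal ((LINT s:{t..T}|lebesgue. r s) + d t T * g (y T)) else \<infinity>)"

definition val :: "real \<Rightarrow> (real \<Rightarrow> real \<Rightarrow> real) \<Rightarrow> ('a::euclidean_space \<Rightarrow> real) \<Rightarrow> ('a \<Rightarrow> real) \<Rightarrow>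
    'a \<Rightarrow> real \<Rightarrow> real" where
  "val T d l g x t = real_of_ereal (INF y \<in> AC T x t. cost T d l g t y)"

text \<open>\<open>inv (grad l)\<close> is the genuine inverse: the gradient of a \<open>C\<^sup>1\<close>, strictly convex, superlinear \<open>l\<close>
  is a bijection. The functions \<open>ctrl\<close>, \<open>traj\<close>, \<open>Vfun\<close>, \<open>Amin\<close> and \<open>wfun\<close> are \<open>U\<close>, \<open>Y\<close>, \<open>V\<close>, \<open>A\<close> and \<open>w\<close>.\<close>

definition ctrl :: "(real \<Rightarrow> real \<Rightarrow> real) \<Rightarrow> ('a::euclidean_space \<Rightarrow> real) \<Rightarrow> real \<Rightarrow> 'a \<Rightarrow> real \<Rightarrow> 'a" where
  "ctrl d l t \<alpha> s = inv (grad l) ((1 / d t s) *\<^sub>R grad l \<alpha>)"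

definition traj :: "(real \<Rightarrow> real \<Rightarrow> real) \<Rightarrow> ('a::euclidean_space \<Rightarrow> real) \<Rightarrow> real \<Rightarrow> 'a \<Rightarrow> 'a \<Rightarrow> real \<Rightarrow> 'a" where
  "traj d l t x \<alpha> s = x + (LINT r:{t..s}|lebesgue. ctrl d l t \<alpha> r)"

definition Vfun :: "real \<Rightarrow> (real \<Rightarrow> real \<Rightarrow> real) \<Rightarrow> ('a::euclidean_space \<Rightarrow> real) \<Rightarrow> ('a \<Rightarrow> real) \<Rightarrow>
    'a \<Rightarrow> real \<Rightarrow> 'a \<Rightarrow> real" where
  "Vfun T d l g x t \<alpha> =
     (LINT s:{t..T}|lebesgue. d t s * l (ctrl d l t \<alpha> s)) + d t T * g (traj d l t x \<alpha> T)"

definition Amin :: "real \<Rightarrow> (real \<Rightarrow> real \<Rightarrow> real) \<Rightarrow> ('a::euclidean_space \<Rightarrow> real) \<Rightarrow> ('a \<Rightarrow> real) \<Rightarrow>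
    'a \<Rightarrow> real \<Rightarrow> 'a set" where
  "Amin T d l g x t = {\<alpha>. is_arg_min (Vfun T d l g x t) (\<lambda>_. True) \<alpha>}"

text \<open>Only \<open>d t s\<close> with \<open>0 \<le> t \<le> s\<close> matters, so the derivative in \<open>t\<close> is taken within \<open>{0..s}\<close>: it is
  one-sided at \<open>t = s\<close> (and at \<open>t = 0\<close>) and two-sided for \<open>0 < t < s\<close>.\<close>

definition dt :: "(real \<Rightarrow> real \<Rightarrow> real) \<Rightarrow> real \<Rightarrow> real \<Rightarrow> real" where
  "dt d t s = vector_derivative (\<lambda>\<tau>. d \<tau> s) (at t within {0..s})"

definition wfun :: "real \<Rightarrow> (real \<Rightarrow> real \<Rightarrow> real) \<Rightarrow> ('a::euclidean_space \<Rightarrow> real) \<Rightarrow> ('a \<Rightarrow> real) \<Rightarrow>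
    'a \<Rightarrow> real \<Rightarrow> 'a \<Rightarrow> real" where
  "wfun T d l g x t \<alpha> =
     (LINT s:{t..T}|lebesgue. dt d t s * l (ctrl d l t \<alpha> s)) + dt d t T * g (traj d l t x \<alpha> T)"

end

theory Submission
  imports Defs
begin

text \<open>By convexity of \<open>l\<close>, the curve driven by \<open>ctrl d l t \<beta>\<close> is the cheapest absolutely continuous curve
  between its end points, and every end point is reached by some \<open>\<beta>\<close>. Hence \<open>val x t = Vfun x t \<alpha>\<close> for a
  minimizer \<open>\<alpha>\<close>. Two families of competitors now bound \<open>val\<close> from above by differentiable functions with
  equality at \<open>(x, t)\<close>: perturbing the initial point with a fixed end point gives
  \<open>v\<^sub>x = - grad l \<alpha>\<close>, and starting at time \<open>\<tau>\<close> on the optimal curve, extended with velocity \<open>\<alpha>\<close> before \<open>t\<close>,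
  gives \<open>v\<^sub>t + v\<^sub>x \<cdot> \<alpha> = - l \<alpha> + w\<close>. Since \<open>l\<^sup>*(grad l \<alpha>) = grad l \<alpha> \<cdot> \<alpha> - l \<alpha>\<close>, this is the equation.

  The lower bound on the cost needs the fundamental theorem of calculus for absolutely continuous
  functions. Almost everywhere differentiability comes from bounded variation on short intervals and
  Vitali's covering theorem, and the integral formula from a Henstock-Kurzweil gauge.\<close>

section \<open>Absolutely continuous functions\<close>

text \<open>The discount depends on the starting time, so a curve that is optimal from
  \<open>t\<close> need not remain optimal from a later time, and dynamic programming gives no
  identity along it. Such a curve is still a competitor at every nearby starting time and so bounds
  \<open>val\<close> from above on both sides of \<open>t\<close>; differentiability of
  \<open>val\<close> at the contact point turns this into equality of derivatives. The term
  \<open>wfun\<close> is the price of the changing discount. Both families keep the terminal point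
  fixed because \<open>g\<close> is only Lipschitz: it enters as a constant and is never
  differentiated. In the second family the control is frozen as well. Strict convexity allows a
  singular Hessian, so the inverse gradient is merely known to be continuous, and
  \<open>ctrl\<close> need not be differentiable in its parameters.\<close>

lemma division_of_real_interval:
  "D division_of S \<Longrightarrow> K \<in> D \<Longrightarrow> \<exists>u v. u \<le> v \<and> K = {u..v::real}"
  by (metis division_ofD(3,4) box_real(2) atLeastatMost_empty_iff)

section \<open>Vitali coverings\<close>

text \<open>Vitali's theorem selects countably many disjoint members of the family that cover
  \<open>S\<close> up to a null set. The bound on finite disjoint subfamilies passes to their
  countable union. The superset \<open>T\<close> stands in for outer measure, since \<open>S\<close>
  is not assumed measurable.\<close>

lemma Vitali_outer_measure_le:
  fixes S :: "real set" and \<K> :: "real set set"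
  assumes ivl: "\<And>K. K \<in> \<K> \<Longrightarrow> \<exists>u v. u < v \<and> K = {u..v}"
    and cov: "\<And>x \<delta>. x \<in> S \<Longrightarrow> 0 < \<delta> \<Longrightarrow> \<exists>K\<in>\<K>. x \<in> K \<and> Sup K - Inf K < \<delta>"
    and bound: "\<And>F. finite F \<Longrightarrow> F \<subseteq> \<K> \<Longrightarrow> pairwise disjnt F \<Longrightarrow> (\<Sum>K\<in>F. Sup K - Inf K) \<le> M"
  obtains T where "S \<subseteq> T" "T \<in> lmeasurable" "measure lebesgue T \<le> M"
proof -
  define c where "c = (\<lambda>K::real set. (Inf K + Sup K) / 2)"
  define r where "r = (\<lambda>K::real set. (Sup K - Inf K) / 2)"
  have cb: "cball (c K) (r K) = K" if "K \<in> \<K>" for K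
    using ivl[OF that] by (auto simp: c_def r_def cball_eq_atLeastAtMost field_simps)
  have rpos: "0 < r K" if "K \<in> \<K>" for K
    using ivl[OF that] by (auto simp: r_def)
  have small: "\<exists>i. i \<in> \<K> \<and> x \<in> cball (c i) (r i) \<and> r i < d" if x: "x \<in> S" and d: "0 < d" for x d
  proof -
    obtain K where "K \<in> \<K>" "x \<in> K" "Sup K - Inf K < 2 * d"
      using cov[OF x, of "2 * d"] d by auto
    then show ?thesis using cb by (intro exI[of _ K]) (auto simp: r_def)
  qed
  obtain C where C: "countable C" "C \<subseteq> \<K>"
    and pw: "pairwise (\<lambda>i j. disjnt (cball (c i) (r i)) (cball (c j) (r j))) C"
    and neg: "negligible (S - (\<Union>i\<in>C. cball (c i) (r i)))"
    by (rule Vitali_covering_theorem_cballs[of \<K> r S c, OF rpos small]) auto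
  have UC: "(\<Union>i\<in>C. cball (c i) (r i)) = (\<Union>K\<in>C. K)" using C cb by auto
  have pwC: "pairwise disjnt C"
    using pw C cb unfolding pairwise_def by (metis subsetD)
  have meas: "K \<in> lmeasurable" "measure lebesgue K = Sup K - Inf K" if "K \<in> C" for K
    using ivl[of K] that C by (auto simp: subset_iff)
  have le: "measure lebesgue (\<Union>K\<in>F. K) \<le> M" if F: "F \<subseteq> C" "finite F" for F
  proof -
    have "measure lebesgue (\<Union>F) \<le> (\<Sum>K\<in>F. measure lebesgue K)"
      using measure_UNION_le[of F "\<lambda>K. K" lebesgue] meas F by (auto simp: fmeasurable_def)
    also have "\<dots> = (\<Sum>K\<in>F. Sup K - Inf K)"
      using meas F by (intro sum.cong) auto
    also have "\<dots> \<le> M"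
      using F C pwC by (intro bound) (auto intro: pairwise_subset)
    finally show ?thesis by simp
  qed
  have U: "(\<Union>K\<in>C. K) \<in> lmeasurable" "measure lebesgue (\<Union>K\<in>C. K) \<le> M"
    using fmeasurable_UN_bound[OF C(1), of "\<lambda>K. K" lebesgue M]
      measure_UN_bound[OF C(1), of "\<lambda>K. K" lebesgue M] meas(1) le by auto
  let ?N = "S - (\<Union>K\<in>C. K)"
  have N: "negligible ?N" using neg UC by simp
  show thesis
  proof
    show "S \<subseteq> ?N \<union> (\<Union>K\<in>C. K)" by auto
    show "?N \<union> (\<Union>K\<in>C. K) \<in> lmeasurable"
      using fmeasurable.Un[OF negligible_imp_measurable[OF N] U(1)] .
    have "measure lebesgue (?N \<union> (\<Union>K\<in>C. K)) \<le> measure lebesgue ?N + measure lebesgue (\<Union>K\<in>C. K)"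
      using N U by (intro measure_Un_le) (auto simp: negligible_imp_measurable fmeasurableD negligible_imp_sets)
    then show "measure lebesgue (?N \<union> (\<Union>K\<in>C. K)) \<le> M"
      using N U by (simp add: negligible_imp_measure0)
  qed
qed

section \<open>Differentiability almost everywhere under bounded variation\<close>

text \<open>Total variation at most \<open>B\<close>. It is phrased with the same partial families
  as \<open>abs_continuous_on\<close>, so that it applies directly to the disjoint intervals that
  come from a Vitali covering.\<close>

definition variation_bound :: "(real \<Rightarrow> 'a::real_normed_vector) \<Rightarrow> real \<Rightarrow> real \<Rightarrow> real \<Rightarrow> bool" where
  "variation_bound f a b B \<longleftrightarrow> (\<forall>D. D division_of \<Union>D \<and> \<Union>D \<subseteq> {a..b} \<longrightarrow>
     (\<Sum>K\<in>D. norm (f (Sup K) - f (Inf K))) \<le> B)"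

lemma disjoint_intervals_division:
  assumes "finite F" "pairwise disjnt F" "\<And>K. K \<in> F \<Longrightarrow> \<exists>u v. u < v \<and> K = {u..v::real}"
  shows "F division_of \<Union>F"
proof (rule division_ofI)
  fix K assume "K \<in> F"
  then obtain u v where "u < v" "K = {u..v}" using assms(3) by blast
  then show "K \<noteq> {}" "\<exists>a b. K = cbox a b" by auto
next
  fix K1 K2 assume "K1 \<in> F" "K2 \<in> F" "K1 \<noteq> K2"
  then have "disjnt K1 K2" using assms(2) by (auto simp: pairwise_def)
  then show "interior K1 \<inter> interior K2 = {}"
    using interior_subset by (fastforce simp: disjnt_def)
qed (use assms in auto)

lemma sum_division_telescope:
  fixes f :: "real \<Rightarrow> 'a::real_normed_vector"
  assumes "a \<le> b" "q division_of {a..b}"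
  shows "(\<Sum>K\<in>q. f (Sup K) - f (Inf K)) = f b - f a"
proof -
  let ?p = "(\<lambda>K. (Inf K, K)) ` q"
  have mem: "Inf K \<in> K" if "K \<in> q" for K
    using division_ofD(3,4)[OF assms(2) that] by auto
  note D = division_ofD[OF assms(2)]
  have "?p tagged_division_of {a..b}"
  proof (rule tagged_division_ofI)
    show "\<Union>{K. \<exists>x. (x, K) \<in> ?p} = {a..b}" using D(6) by blast
  next
    fix x K assume "(x, K) \<in> ?p"
    then show "x \<in> K" "K \<subseteq> {a..b}" "\<exists>a b. K = cbox a b" using D(2,4) mem by blast+
  next
    fix x1 K1 x2 K2 assume "(x1, K1) \<in> ?p" "(x2, K2) \<in> ?p" "(x1, K1) \<noteq> (x2, K2)"
    then show "interior K1 \<inter> interior K2 = {}" using D(5)[of K1 K2] by blast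
  qed (use D(1) in auto)
  then have "(\<Sum>(x,K)\<in>?p. f (Sup K) - f (Inf K)) = f b - f a"
    by (rule additive_tagged_division_1[OF assms(1)])
  then show ?thesis by (subst (asm) sum.reindex) (auto simp: inj_on_def)
qed

text \<open>Every term \<open>\<bar>z\<bar> - s * z\<close> is nonnegative, so enlarging
  \<open>F\<close> to a division of the whole interval only adds to the sum, while the signed
  increments telescope. With \<open>s\<close> the sign of the total increment, each interval of
  \<open>F\<close> that moves the other way yields a gain in variation.\<close>

lemma signed_refinement:
  fixes f :: "real \<Rightarrow> real"
  assumes "u \<le> v" "F division_of \<Union>F" "\<Union>F \<subseteq> {u..v}" "\<bar>s\<bar> \<le> 1"
  obtains q where "q division_of {u..v}"
    "s * (f v - f u) + (\<Sum>k\<in>F. \<bar>f (Sup k) - f (Inf k)\<bar> - s * (f (Sup k) - f (Inf k)))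
       \<le> (\<Sum>k\<in>q. \<bar>f (Sup k) - f (Inf k)\<bar>)"
proof -
  obtain q where q: "F \<subseteq> q" "q division_of {u..v}"
    using partial_division_extend_interval[OF assms(2)] assms(3) by (metis box_real(2))
  have nn: "0 \<le> \<bar>z\<bar> - s * z" for z :: real
  proof -
    have "s * z \<le> \<bar>s\<bar> * \<bar>z\<bar>" by (metis abs_ge_self abs_mult)
    also have "\<dots> \<le> \<bar>z\<bar>" using assms(4) by (simp add: mult_left_le_one_le)
    finally show ?thesis by simp
  qed
  have "(\<Sum>k\<in>F. \<bar>f (Sup k) - f (Inf k)\<bar> - s * (f (Sup k) - f (Inf k)))
     \<le> (\<Sum>k\<in>q. \<bar>f (Sup k) - f (Inf k)\<bar> - s * (f (Sup k) - f (Inf k)))"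
    using q nn by (intro sum_mono2) auto
  also have "\<dots> = (\<Sum>k\<in>q. \<bar>f (Sup k) - f (Inf k)\<bar>) - s * (f v - f u)"
    by (simp only: sum_subtractf[of _ "\<lambda>k. s * _ k"] sum_distrib_left[symmetric]
        sum_division_telescope[OF assms(1) q(2), of f])
  finally show thesis using that q by simp
qed

lemma refinements_variation:
  fixes f :: "real \<Rightarrow> 'a::real_normed_vector"
  assumes var: "variation_bound f a b B" and D: "D division_of \<Union>D" "\<Union>D \<subseteq> {a..b}"
    and q: "\<And>K. K \<in> D \<Longrightarrow> q K division_of K"
  shows "(\<Sum>K\<in>D. \<Sum>k\<in>q K. norm (f (Sup k) - f (Inf k))) \<le> B"
proof -
  \<comment> \<open>A one-point interval may occur in the divisions of two adjacent members of
    \<open>D\<close>. Dropping those, whose increments vanish, makes the families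
    \<open>q' K\<close> disjoint.\<close>
  define q' where "q' K = {k \<in> q K. Inf k < Sup k}" for K
  have ivl: "\<exists>u v. u \<le> v \<and> k = {u..v}" if "k \<in> q K" "K \<in> D" for k K
    using division_of_real_interval[OF q[OF that(2)] that(1)] .
  have fin: "finite (q' K)" if "K \<in> D" for K
    using q[OF that] by (auto simp: q'_def)
  have int: "interior k1 \<inter> interior k2 = {}"
    if "K1 \<in> D" "K2 \<in> D" "k1 \<in> q' K1" "k2 \<in> q' K2" "K1 \<noteq> K2 \<or> k1 \<noteq> k2" for K1 K2 k1 k2
  proof (cases "K1 = K2")
    case True
    then show ?thesis using that division_ofD(5)[OF q] by (auto simp: q'_def)
  next
    case False
    then have "interior K1 \<inter> interior K2 = {}" using division_ofD(5)[OF D(1)] that by auto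
    moreover have "k1 \<subseteq> K1" "k2 \<subseteq> K2"
      using that division_ofD(2)[OF q] by (auto simp: q'_def)
    then have "interior k1 \<subseteq> interior K1" "interior k2 \<subseteq> interior K2"
      by (simp_all add: interior_mono)
    ultimately show ?thesis by blast
  qed
  have ne: "interior k \<noteq> {}" if "k \<in> q' K" "K \<in> D" for k K
    using ivl[of k K] that by (auto simp: q'_def)
  have disj: "q' K1 \<inter> q' K2 = {}" if "K1 \<in> D" "K2 \<in> D" "K1 \<noteq> K2" for K1 K2
    using int[OF that(1,2)] ne that by blast
  have div: "(\<Union>K\<in>D. q' K) division_of \<Union>(\<Union>K\<in>D. q' K)"
  proof (rule division_ofI)
    show "finite (\<Union>K\<in>D. q' K)" using fin D by auto
  next
    fix k assume "k \<in> (\<Union>K\<in>D. q' K)"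
    then show "k \<noteq> {}" "\<exists>a b. k = cbox a b" using ivl q'_def by fastforce+
  next
    fix k1 k2 assume "k1 \<in> (\<Union>K\<in>D. q' K)" "k2 \<in> (\<Union>K\<in>D. q' K)" "k1 \<noteq> k2"
    then show "interior k1 \<inter> interior k2 = {}" using int by blast
  qed auto
  have sub: "\<Union>(\<Union>K\<in>D. q' K) \<subseteq> {a..b}"
    using division_ofD(2)[OF q] D(2) by (force simp: q'_def)
  have "(\<Sum>K\<in>D. \<Sum>k\<in>q K. norm (f (Sup k) - f (Inf k)))
      = (\<Sum>K\<in>D. \<Sum>k\<in>q' K. norm (f (Sup k) - f (Inf k)))"
  proof (rule sum.cong[OF refl], rule sum.mono_neutral_right)
    fix K assume K: "K \<in> D"
    show "finite (q K)" using q[OF K] by auto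
    show "\<forall>k\<in>q K - q' K. norm (f (Sup k) - f (Inf k)) = 0"
      using ivl K by (fastforce simp: q'_def)
  qed (auto simp: q'_def)
  also have "\<dots> = (\<Sum>k\<in>(\<Union>K\<in>D. q' K). norm (f (Sup k) - f (Inf k)))"
    using D(1) fin disj by (subst sum.UNION_disjoint) auto
  also have "\<dots> \<le> B" using var div sub unfolding variation_bound_def by blast
  finally show ?thesis .
qed

text \<open>A difference quotient is symmetric in its two points, so \<open>z\<close> on either side
  of \<open>x\<close> gives an interval with end point \<open>x\<close> and that same slope.\<close>

lemma slope_interval:
  fixes f :: "real \<Rightarrow> real"
  assumes "z \<noteq> x" "\<bar>z - x\<bar> < \<delta>"
  obtains u v where "u < v" "x \<in> {u..v}" "z \<in> {u..v}" "v - u < \<delta>" "{u, v} = {x, z}"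
    "f v - f u = (f z - f x) / (z - x) * (v - u)"
proof (cases "x < z")
  case True
  with assms show thesis by (intro that[of x z]) (auto simp: field_simps)
next
  case False
  with assms show thesis by (intro that[of z x]) (auto simp: field_simps)
qed

text \<open>A Chebyshev estimate: intervals on which \<open>f\<close> moves by at least
  \<open>C\<close> times their length form a Vitali covering, and disjoint ones have total length at
  most \<open>B / C\<close>.\<close>

lemma negligible_unbounded_slopes:
  fixes f :: "real \<Rightarrow> real"
  assumes var: "variation_bound f a b B"
  shows "negligible {x \<in> {a<..<b}. \<forall>C. \<exists>\<^sub>F z in at x. \<bar>(f z - f x) / (z - x)\<bar> > C}" (is "negligible ?E")
  unfolding negligible_outer_le
proof (intro allI impI)
  fix e :: real assume e: "e > 0"
  have "0 \<le> B" using var[unfolded variation_bound_def, rule_format, of "{}"] by simp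
  \<comment> \<open>This makes \<open>B / C \<le> e\<close>; the summand 1 keeps \<open>C\<close>
    positive when \<open>B = 0\<close>.\<close>
  define C where "C = (B + 1) / e"
  have C: "C > 0" "B / C \<le> e" using e \<open>0 \<le> B\<close> by (auto simp: C_def field_simps)
  let ?K = "{{u..v} | u v. u < v \<and> {u..v} \<subseteq> {a..b} \<and> \<bar>f v - f u\<bar> \<ge> C * (v - u)}"
  show "\<exists>T. ?E \<subseteq> T \<and> T \<in> lmeasurable \<and> measure lebesgue T \<le> e"
  proof (rule Vitali_outer_measure_le[of ?K ?E "B / C"])
    fix x \<delta> :: real assume x: "x \<in> ?E" and \<delta>: "0 < \<delta>"
    then have "\<exists>\<^sub>F z in at x. \<bar>(f z - f x) / (z - x)\<bar> > C" by blast
    moreover have "0 < min \<delta> (min (x - a) (b - x))" using x \<delta> by auto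
    ultimately obtain z where z: "z \<noteq> x" "dist z x < min \<delta> (min (x - a) (b - x))"
        "\<bar>(f z - f x) / (z - x)\<bar> > C"
      unfolding frequently_at by blast
    then have "\<bar>z - x\<bar> < \<delta>" by (simp add: dist_real_def)
    with z(1) obtain u v where uv: "u < v" "x \<in> {u..v}" "z \<in> {u..v}" "v - u < \<delta>" "{u, v} = {x, z}"
        "f v - f u = (f z - f x) / (z - x) * (v - u)"
      using slope_interval[of z x \<delta> f] by blast
    have "\<bar>f v - f u\<bar> = \<bar>(f z - f x) / (z - x)\<bar> * (v - u)"
      using uv(1,6) by (simp add: abs_mult)
    then have "\<bar>f v - f u\<bar> \<ge> C * (v - u)" using z(3) uv(1) by (metis less_eq_real_def diff_gt_0_iff_gt mult_right_mono)
    moreover have "{u..v} \<subseteq> {a..b}" using uv(5) z(2) x by (auto simp: dist_real_def doubleton_eq_iff)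
    ultimately have "{u..v} \<in> ?K" using uv(1) by blast
    then show "\<exists>K\<in>?K. x \<in> K \<and> Sup K - Inf K < \<delta>"
      using uv by (intro bexI[of _ "{u..v}"]) auto
  next
    fix F assume F: "finite F" "F \<subseteq> ?K" "pairwise disjnt F"
    have ivl: "\<exists>u v. u < v \<and> K = {u..v}" if "K \<in> F" for K using subsetD[OF F(2) that] by blast
    have "F division_of \<Union>F" using F(1,3) ivl by (rule disjoint_intervals_division)
    moreover have "\<Union>F \<subseteq> {a..b}" using F(2) by blast
    ultimately have "(\<Sum>K\<in>F. norm (f (Sup K) - f (Inf K))) \<le> B"
      using var unfolding variation_bound_def by blast
    moreover have "C * (Sup K - Inf K) \<le> norm (f (Sup K) - f (Inf K))" if "K \<in> F" for K
    proof -
      have "K \<in> ?K" using F(2) that by (rule subsetD)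
      then obtain u v where "K = {u..v}" "u < v" "\<bar>f v - f u\<bar> \<ge> C * (v - u)" unfolding mem_Collect_eq by metis
      then show ?thesis by simp
    qed
    then have "(\<Sum>K\<in>F. C * (Sup K - Inf K)) \<le> (\<Sum>K\<in>F. norm (f (Sup K) - f (Inf K)))"
      by (intro sum_mono)
    ultimately have "(\<Sum>K\<in>F. Sup K - Inf K) * C \<le> B"
      unfolding sum_distrib_left[symmetric] by (simp only: mult.commute)
    then show "(\<Sum>K\<in>F. Sup K - Inf K) \<le> B / C"
      using C(1) by (subst pos_le_divide_eq)
  next
    fix T assume "?E \<subseteq> T" "T \<in> lmeasurable" "measure lebesgue T \<le> B / C"
    then show ?thesis using C(2) by (intro exI[of _ T]) auto
  qed blast
qed

text \<open>A partial family within \<open>e\<close> of the supremum of the variation stays so when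
  it is extended to a division of \<open>{a..b}\<close>, because the added terms are
  nonnegative.\<close>

lemma near_maximal_division:
  fixes f :: "real \<Rightarrow> real"
  assumes "variation_bound f a b B" "e > 0"
  obtains D where "D division_of {a..b}"
    "variation_bound f a b ((\<Sum>K\<in>D. \<bar>f (Sup K) - f (Inf K)\<bar>) + e)"
proof -
  let ?S = "\<lambda>D. \<Sum>K\<in>D. \<bar>f (Sup K) - f (Inf K)\<bar>"
  let ?P = "\<lambda>D. D division_of \<Union>D \<and> \<Union>D \<subseteq> {a..b}"
  have ub: "?S D \<le> B" if "?P D" for D using assms(1) that by (auto simp: variation_bound_def)
  have bdd: "bdd_above (?S ` Collect ?P)" using ub by (intro bdd_aboveI[of _ B]) auto
  have ne: "?S ` Collect ?P \<noteq> {}" by (auto intro!: exI[of _ "{}"])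
  obtain D where D: "?P D" "Sup (?S ` Collect ?P) - e < ?S D"
    using less_cSup_iff[OF ne bdd, of "Sup (?S ` Collect ?P) - e"] assms(2) by auto
  obtain q where q: "D \<subseteq> q" "q division_of {a..b}"
    using partial_division_extend_interval[of D a b] D(1) by (metis box_real(2))
  have Dq: "?S D \<le> ?S q" using q by (intro sum_mono2) auto
  have "?S D' \<le> ?S q + e" if "?P D'" for D'
  proof -
    have "?S D' \<le> Sup (?S ` Collect ?P)" using that by (intro cSup_upper[OF _ bdd]) auto
    then show ?thesis using Dq D(2) by linarith
  qed
  then show thesis using q(2) by (intro that[of q]) (auto simp: variation_bound_def)
qed

lemma sum_UNION_le:
  fixes f :: "'a \<Rightarrow> real"
  assumes "finite I" "\<And>i. i \<in> I \<Longrightarrow> finite (A i)" "\<And>i x. i \<in> I \<Longrightarrow> x \<in> A i \<Longrightarrow> 0 \<le> f x"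
  shows "sum f (\<Union>i\<in>I. A i) \<le> (\<Sum>i\<in>I. sum f (A i))"
  using assms
proof (induction I)
  case (insert i I)
  have "sum f (A i \<union> (\<Union>i\<in>I. A i)) \<le> sum f (A i) + sum f (\<Union>i\<in>I. A i)"
    using insert.prems insert.hyps by (subst sum.union_inter[symmetric]) (auto intro!: sum_nonneg)
  with insert show ?case by fastforce
qed simp

text \<open>Vitali intervals on which \<open>f\<close> moves against its total increment over the enclosing interval of a
  division \<open>D\<close> would, if added to \<open>D\<close>, increase the variation by \<open>2 c\<close> times their total length. For \<open>D\<close> of
  nearly maximal variation, that length is therefore small.\<close>

lemma negligible_oscillating_slopes:
  fixes f :: "real \<Rightarrow> real"
  assumes var: "variation_bound f a b B" and c: "c > 0"
  shows "negligible {x \<in> {a<..<b}. (\<exists>\<^sub>F z in at x. (f z - f x) / (z - x) > c) \<and>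
    (\<exists>\<^sub>F z in at x. (f z - f x) / (z - x) < - c)}" (is "negligible ?E")
  unfolding negligible_outer_le
proof (intro allI impI)
  fix e :: real assume e: "e > 0"
  have e': "c * e > 0" using e c by simp
  obtain D where D: "D division_of {a..b}"
    and max: "variation_bound f a b ((\<Sum>K\<in>D. \<bar>f (Sup K) - f (Inf K)\<bar>) + c * e)"
    using near_maximal_division[OF var e'] by blast
  note DD = division_ofD[OF D]
  have DU: "D division_of \<Union>D" "\<Union>D \<subseteq> {a..b}" using D DD(6) by auto
  \<comment> \<open>The sign of the total increment over \<open>K\<close>; either sign would do when
    that increment is 0.\<close>
  define s where "s K = (if f (Sup K) - f (Inf K) \<ge> 0 then 1 else - 1 :: real)" for K
  have s: "\<bar>s K\<bar> \<le> 1" "s K * (f (Sup K) - f (Inf K)) = \<bar>f (Sup K) - f (Inf K)\<bar>" for K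
    by (auto simp: s_def)
  let ?P = "\<lambda>K u v. {u..v} \<subseteq> K \<and> s K * (f v - f u) \<le> - (c * (v - u))"
  let ?K = "{{u..v} | u v. u < v \<and> (\<exists>K\<in>D. ?P K u v)}"
  have ivD: "\<exists>u v. u \<le> v \<and> K = {u..v}" if "K \<in> D" for K
    using division_of_real_interval[OF D that] .
  \<comment> \<open>Discarding the finitely many end points of \<open>D\<close> puts
    \<open>x\<close> in the interior of some \<open>K\<close>, so that small intervals at
    \<open>x\<close> stay inside \<open>K\<close>.\<close>
  let ?N = "Sup ` D \<union> Inf ` D"
  have N: "finite ?N" using DD(1) by auto
  show "\<exists>T. ?E \<subseteq> T \<and> T \<in> lmeasurable \<and> measure lebesgue T \<le> e"
  proof (rule Vitali_outer_measure_le[of ?K "?E - ?N" e])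
    fix x \<delta> :: real assume x: "x \<in> ?E - ?N" and \<delta>: "0 < \<delta>"
    then obtain K where K: "K \<in> D" "x \<in> K" using DD(6) by (metis (no_types, lifting) DiffD1 UnionE
        atLeastAtMost_iff greaterThanLessThan_iff less_imp_le mem_Collect_eq)
    then obtain p q where pq: "p \<le> q" "K = {p..q}" using ivD by blast
    with K x have "p \<noteq> x" "q \<noteq> x" by (force, force)
    with pq K have x': "p < x" "x < q" by auto
    \<comment> \<open>Slopes of both signs recur at \<open>x\<close>, so one of the two kinds
      opposes \<open>s K\<close>, whatever its value.\<close>
    have "\<exists>\<^sub>F z in at x. s K * ((f z - f x) / (z - x)) < - c"
    proof (cases "s K = 1")
      case True
      then show ?thesis using x by simp
    next
      case False
      then have "s K = - 1" by (auto simp: s_def split: if_splits)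
      then have "(s K * ((f z - f x) / (z - x)) < - c) = ((f z - f x) / (z - x) > c)" for z
        by (simp only:) linarith
      then show ?thesis using x by simp
    qed
    moreover have "0 < min \<delta> (min (x - p) (q - x))" using x' \<delta> by auto
    ultimately obtain z where z: "z \<noteq> x" "dist z x < min \<delta> (min (x - p) (q - x))"
        "s K * ((f z - f x) / (z - x)) < - c"
      unfolding frequently_at by blast
    then have "\<bar>z - x\<bar> < \<delta>" by (simp add: dist_real_def)
    with z(1) obtain u v where uv: "u < v" "x \<in> {u..v}" "z \<in> {u..v}" "v - u < \<delta>" "{u, v} = {x, z}"
        "f v - f u = (f z - f x) / (z - x) * (v - u)"
      using slope_interval[of z x \<delta> f] by blast
    have "s K * (f v - f u) = s K * ((f z - f x) / (z - x)) * (v - u)"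
      using uv(6) by simp
    also have "\<dots> \<le> - c * (v - u)" using z(3) uv(1) by (intro mult_right_mono) auto
    finally have "s K * (f v - f u) \<le> - (c * (v - u))" by simp
    moreover have "{u..v} \<subseteq> K" using uv(5) z(2) pq x' by (auto simp: dist_real_def doubleton_eq_iff)
    ultimately have "{u..v} \<in> ?K" using uv(1) K(1) by blast
    then show "\<exists>K\<in>?K. x \<in> K \<and> Sup K - Inf K < \<delta>"
      using uv by (intro bexI[of _ "{u..v}"]) auto
  next
    fix F assume F: "finite F" "F \<subseteq> ?K" "pairwise disjnt F"
    have ivl: "\<exists>u v. u < v \<and> k = {u..v}" if "k \<in> F" for k using subsetD[OF F(2) that] by blast
    define G where "G K = {k \<in> F. ?P K (Inf k) (Sup k)}" for K
    have UG: "F \<subseteq> (\<Union>K\<in>D. G K)"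
    proof
      fix k assume k: "k \<in> F"
      obtain u v K where "k = {u..v}" "u < v" "K \<in> D" "?P K u v"
        using subsetD[OF F(2) k] by (elim CollectE exE conjE bexE) (rule that; (intro conjI)?; assumption)
      with k show "k \<in> (\<Union>K\<in>D. G K)"
        by (intro UN_I[of K]) (simp_all add: G_def)
    qed
    have "\<exists>q. q division_of K \<and> \<bar>f (Sup K) - f (Inf K)\<bar> + (\<Sum>k\<in>G K. 2 * c * (Sup k - Inf k))
        \<le> (\<Sum>k\<in>q. \<bar>f (Sup k) - f (Inf k)\<bar>)" if "K \<in> D" for K
    proof -
      obtain u v where uv: "u \<le> v" "K = {u..v}" using ivD \<open>K \<in> D\<close> by blast
      have Gdiv: "G K division_of \<Union>(G K)" using F ivl
        by (intro disjoint_intervals_division) (auto simp: G_def intro: pairwise_subset)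
      have Gsub: "\<Union>(G K) \<subseteq> {u..v}"
      proof
        fix z assume "z \<in> \<Union>(G K)"
        then obtain k where k: "k \<in> F" "z \<in> k" "{Inf k..Sup k} \<subseteq> K" by (auto simp: G_def)
        with ivl[OF k(1)] uv show "z \<in> {u..v}" by auto
      qed
      obtain q where q: "q division_of {u..v}"
        "s K * (f v - f u) + (\<Sum>k\<in>G K. \<bar>f (Sup k) - f (Inf k)\<bar> - s K * (f (Sup k) - f (Inf k)))
          \<le> (\<Sum>k\<in>q. \<bar>f (Sup k) - f (Inf k)\<bar>)"
        by (rule signed_refinement[OF uv(1) Gdiv Gsub s(1)[of K]])
      \<comment> \<open>An opposing interval contributes at least \<open>c\<close> times its length
        through the absolute increment and as much again through the signed term, hence the factor
        2.\<close>
      have "(\<Sum>k\<in>G K. 2 * c * (Sup k - Inf k))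
          \<le> (\<Sum>k\<in>G K. \<bar>f (Sup k) - f (Inf k)\<bar> - s K * (f (Sup k) - f (Inf k)))"
      proof (rule sum_mono)
        fix k assume "k \<in> G K"
        then have "s K * (f (Sup k) - f (Inf k)) \<le> - (c * (Sup k - Inf k))" by (simp add: G_def)
        moreover have "- (s K * (f (Sup k) - f (Inf k))) \<le> \<bar>f (Sup k) - f (Inf k)\<bar>"
          by (auto simp: s_def)
        ultimately show "2 * c * (Sup k - Inf k) \<le> \<bar>f (Sup k) - f (Inf k)\<bar> - s K * (f (Sup k) - f (Inf k))"
          by linarith
      qed
      moreover have "s K * (f v - f u) = \<bar>f (Sup K) - f (Inf K)\<bar>" using s(2)[of K] uv by simp
      ultimately show ?thesis using q uv by (intro exI[of _ q]) auto
    qed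
    then have "\<exists>q. \<forall>K\<in>D. q K division_of K \<and> \<bar>f (Sup K) - f (Inf K)\<bar> + (\<Sum>k\<in>G K. 2 * c * (Sup k - Inf k))
        \<le> (\<Sum>k\<in>q K. \<bar>f (Sup k) - f (Inf k)\<bar>)"
      by (intro bchoice ballI)
    then obtain q where q: "\<And>K. K \<in> D \<Longrightarrow> q K division_of K"
      "\<And>K. K \<in> D \<Longrightarrow> \<bar>f (Sup K) - f (Inf K)\<bar> + (\<Sum>k\<in>G K. 2 * c * (Sup k - Inf k))
        \<le> (\<Sum>k\<in>q K. \<bar>f (Sup k) - f (Inf k)\<bar>)" by blast
    have nn: "0 \<le> 2 * c * (Sup k - Inf k)" if "k \<in> F" for k using ivl[OF that] c by auto
    have "(\<Sum>k\<in>F. 2 * c * (Sup k - Inf k)) \<le> (\<Sum>k\<in>(\<Union>K\<in>D. G K). 2 * c * (Sup k - Inf k))"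
      using UG F(1) DD(1) nn by (intro sum_mono2) (auto simp: G_def)
    also have "\<dots> \<le> (\<Sum>K\<in>D. \<Sum>k\<in>G K. 2 * c * (Sup k - Inf k))"
      using nn F(1) DD(1) by (intro sum_UNION_le) (auto simp: G_def)
    finally have "(\<Sum>K\<in>D. \<bar>f (Sup K) - f (Inf K)\<bar>) + (\<Sum>k\<in>F. 2 * c * (Sup k - Inf k))
        \<le> (\<Sum>K\<in>D. \<bar>f (Sup K) - f (Inf K)\<bar> + (\<Sum>k\<in>G K. 2 * c * (Sup k - Inf k)))"
      by (simp add: sum.distrib)
    also have "\<dots> \<le> (\<Sum>K\<in>D. \<Sum>k\<in>q K. norm (f (Sup k) - f (Inf k)))"
      using q(2) by (intro sum_mono) auto
    also have "\<dots> \<le> (\<Sum>K\<in>D. \<bar>f (Sup K) - f (Inf K)\<bar>) + c * e"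
      by (rule refinements_variation[OF max DU q(1)])
    finally have "2 * c * (\<Sum>k\<in>F. Sup k - Inf k) \<le> c * e" by (simp add: sum_distrib_left)
    then have "2 * (\<Sum>k\<in>F. Sup k - Inf k) \<le> e" using c by (simp add: mult.assoc mult.left_commute[of 2 c])
    then show "(\<Sum>k\<in>F. Sup k - Inf k) \<le> e" using e by linarith
  next
    fix T assume T: "?E - ?N \<subseteq> T" "T \<in> lmeasurable" "measure lebesgue T \<le> e"
    have N': "negligible ?N" using N by (rule negligible_finite)
    then have "measure lebesgue (T \<union> ?N) \<le> measure lebesgue T + measure lebesgue ?N"
      using T by (intro measure_Un_le) (auto simp: negligible_imp_measurable fmeasurableD negligible_imp_sets)
    then show ?thesis using T N'
      by (intro exI[of _ "T \<union> ?N"]) (auto simp: negligible_imp_measure0 negligible_imp_measurable)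
  qed blast
qed

lemma variation_bound_subtract_linear:
  fixes f :: "real \<Rightarrow> real"
  assumes "variation_bound f a b B"
  shows "variation_bound (\<lambda>x. f x - m * x) a b (B + \<bar>m\<bar> * \<bar>b - a\<bar>)"
  unfolding variation_bound_def
proof (intro allI impI)
  fix D assume D: "D division_of \<Union>D \<and> \<Union>D \<subseteq> {a..b}"
  have ivl: "\<exists>u v. u \<le> v \<and> k = {u..v}" if "k \<in> D" for k
    using division_of_real_interval D that by blast
  have "(\<Sum>K\<in>D. norm (f (Sup K) - m * Sup K - (f (Inf K) - m * Inf K)))
      \<le> (\<Sum>K\<in>D. norm (f (Sup K) - f (Inf K)) + \<bar>m\<bar> * measure lborel K)"
  proof (rule sum_mono)
    fix K assume "K \<in> D"
    then obtain u v where uv: "u \<le> v" "K = {u..v}" using ivl by blast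
    have "norm (f v - m * v - (f u - m * u)) = norm ((f v - f u) - m * (v - u))"
      by (simp add: algebra_simps)
    also have "\<dots> \<le> norm (f v - f u) + norm (m * (v - u))" by (rule norm_triangle_ineq4)
    finally show "norm (f (Sup K) - m * Sup K - (f (Inf K) - m * Inf K))
        \<le> norm (f (Sup K) - f (Inf K)) + \<bar>m\<bar> * measure lborel K"
      using uv by (simp add: abs_mult)
  qed
  also have "\<dots> = (\<Sum>K\<in>D. norm (f (Sup K) - f (Inf K))) + \<bar>m\<bar> * (\<Sum>K\<in>D. measure lborel K)"
    by (simp add: sum.distrib sum_distrib_left)
  also have "\<dots> \<le> B + \<bar>m\<bar> * \<bar>b - a\<bar>"
  proof (intro add_mono mult_left_mono)
    show "(\<Sum>K\<in>D. norm (f (Sup K) - f (Inf K))) \<le> B"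
      using assms D by (auto simp: variation_bound_def)
    have "(\<Sum>K\<in>D. measure lborel K) \<le> measure lborel (cbox a b)"
      using subadditive_content_division[of D "\<Union>D" a b] D unfolding box_real by blast
    also have "\<dots> \<le> \<bar>b - a\<bar>" by (cases "a \<le> b") auto
    finally show "(\<Sum>K\<in>D. measure lborel K) \<le> \<bar>b - a\<bar>" .
  qed auto
  finally show "(\<Sum>K\<in>D. norm (f (Sup K) - m * Sup K - (f (Inf K) - m * Inf K))) \<le> B + \<bar>m\<bar> * \<bar>b - a\<bar>" .
qed

text \<open>Boundedness makes the lower and upper limits of the quotient finite. If they differed,
  two rationals strictly between them would contradict \<open>osc\<close>. Restricting to rationals
  keeps the exceptional sets countable in number.\<close>

lemma differentiable_if_slopes_settle:
  fixes f :: "real \<Rightarrow> real"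
  assumes bdd: "\<not> (\<forall>C. \<exists>\<^sub>F z in at x. \<bar>(f z - f x) / (z - x)\<bar> > C)"
    and osc: "\<And>p q. p \<in> \<rat> \<Longrightarrow> q \<in> \<rat> \<Longrightarrow> p < q \<Longrightarrow>
      \<not> ((\<exists>\<^sub>F z in at x. (f z - f x) / (z - x) < p) \<and> (\<exists>\<^sub>F z in at x. (f z - f x) / (z - x) > q))"
  shows "f differentiable (at x)"
proof -
  let ?r = "\<lambda>z. (f z - f x) / (z - x)"
  let ?l = "Liminf (at x) (\<lambda>z. ereal (?r z))" and ?u = "Limsup (at x) (\<lambda>z. ereal (?r z))"
  obtain C where C: "\<forall>\<^sub>F z in at x. \<bar>?r z\<bar> \<le> C"
    using bdd by (auto simp: frequently_def not_less)
  have nt: "at x \<noteq> bot" by simp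
  have lu: "?l \<le> ?u" by (rule Liminf_le_Limsup[OF nt])
  have "\<forall>\<^sub>F z in at x. ereal (?r z) \<le> ereal C" using C by eventually_elim (simp only: abs_le_iff ereal_less_eq)
  then have uC: "?u \<le> ereal C" by (rule Limsup_bounded)
  have "\<forall>\<^sub>F z in at x. ereal (- C) \<le> ereal (?r z)" using C by eventually_elim (simp only: abs_le_iff ereal_less_eq minus_le_iff)
  then have lC: "ereal (- C) \<le> ?l" by (rule Liminf_bounded)
  have eq: "?l = ?u"
  proof (rule ccontr)
    assume "?l \<noteq> ?u"
    with lu have less: "?l < ?u" by simp
    obtain p' where p': "?l < ereal p'" "ereal p' < ?u" using ereal_dense2[OF less] by blast
    obtain q' where q': "ereal p' < ereal q'" "ereal q' < ?u" using ereal_dense2[OF p'(2)] by blast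
    have pq': "p' < q'" using q'(1) by simp
    obtain p where p: "p \<in> \<rat>" "p' < p" "p < q'" using Rats_dense_in_real[OF pq'] by blast
    obtain q where q: "q \<in> \<rat>" "p < q" "q < q'" using Rats_dense_in_real[OF p(3)] by blast
    have pl: "?l < ereal p" using p'(1) p(2) by (elim less_trans) simp
    have qu: "ereal q < ?u" using q(3) q'(2) by (intro less_trans[OF _ q'(2)]) simp
    have "\<exists>\<^sub>F z in at x. ?r z < p"
    proof (rule ccontr)
      assume "\<not> (\<exists>\<^sub>F z in at x. ?r z < p)"
      then have "\<forall>\<^sub>F z in at x. ereal p \<le> ereal (?r z)" by (simp add: frequently_def not_less)
      then have "ereal p \<le> ?l" by (rule Liminf_bounded)
      with pl show False by simp
    qed
    moreover have "\<exists>\<^sub>F z in at x. ?r z > q"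
    proof (rule ccontr)
      assume "\<not> (\<exists>\<^sub>F z in at x. ?r z > q)"
      then have "\<forall>\<^sub>F z in at x. ereal (?r z) \<le> ereal q" by (simp add: frequently_def not_less)
      then have "?u \<le> ereal q" by (rule Limsup_bounded)
      with qu show False by simp
    qed
    ultimately show False using osc[OF p(1) q(1) q(2)] by blast
  qed
  obtain r where r: "?u = ereal r" using uC lC eq by (cases ?u) auto
  have "((\<lambda>z. ereal (?r z)) \<longlongrightarrow> ereal r) (at x)"
    using tendsto_iff_Liminf_eq_Limsup[OF nt] eq r by metis
  then have "(?r \<longlongrightarrow> r) (at x)" by simp
  then have "(f has_field_derivative r) (at x)"
    by (simp add: has_field_derivative_iff)
  then show ?thesis unfolding has_field_derivative_def by (rule differentiableI)
qed

lemma variation_bound_differentiable_ae: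
  fixes f :: "real \<Rightarrow> real"
  assumes var: "variation_bound f a b B"
  shows "negligible {x \<in> {a<..<b}. \<not> f differentiable (at x)}"
proof -
  let ?r = "\<lambda>x z. (f z - f x) / (z - x)"
  let ?Z = "{x \<in> {a<..<b}. \<forall>C. \<exists>\<^sub>F z in at x. \<bar>?r x z\<bar> > C}"
  let ?E = "\<lambda>(p, q). {x \<in> {a<..<b}. (\<exists>\<^sub>F z in at x. ?r x z < p) \<and> (\<exists>\<^sub>F z in at x. ?r x z > q)}"
  let ?I = "{(p::real, q). p \<in> \<rat> \<and> q \<in> \<rat> \<and> p < q}"
  have cnt: "countable ?I"
    by (rule countable_subset[of _ "\<rat> \<times> \<rat>"]) (auto simp: countable_rat)
  have E: "negligible (?E pq)" if I: "pq \<in> ?I" for pq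
  proof -
    obtain p q where pq: "pq = (p, q)" "p < q" using I by auto
    \<comment> \<open>Subtracting the line of slope \<open>m\<close> moves the thresholds
      \<open>p\<close> and \<open>q\<close> to the symmetric pair required by
      \<open>negligible_oscillating_slopes\<close>.\<close>
    define m where "m = (p + q) / 2"
    have "(q - p) / 2 > 0" using pq by simp
    from negligible_oscillating_slopes[OF variation_bound_subtract_linear[OF var, of m] this]
    have neg: "negligible {x \<in> {a<..<b}. (\<exists>\<^sub>F z in at x. (f z - m * z - (f x - m * x)) / (z - x) > (q - p) / 2) \<and>
      (\<exists>\<^sub>F z in at x. (f z - m * z - (f x - m * x)) / (z - x) < - ((q - p) / 2))}" .
    have slope: "(f z - m * z - (f x - m * x)) / (z - x) = ?r x z - m" if "z \<noteq> x" for x z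
      using that by (simp add: field_simps)
    have shift: "(r - m > (q - p) / 2) = (r > q)" "(r - m < - ((q - p) / 2)) = (r < p)" for r
      by (auto simp: m_def field_simps)
    have up: "(\<exists>\<^sub>F z in at x. (f z - m * z - (f x - m * x)) / (z - x) > (q - p) / 2)
        \<longleftrightarrow> (\<exists>\<^sub>F z in at x. ?r x z > q)" for x
      by (rule frequently_cong[of "\<lambda>z. z \<noteq> x"])
        (auto simp only: eventually_at_filter slope shift simp_thms eventually_True imp_disjL intro!: always_eventually)
    have down: "(\<exists>\<^sub>F z in at x. (f z - m * z - (f x - m * x)) / (z - x) < - ((q - p) / 2))
        \<longleftrightarrow> (\<exists>\<^sub>F z in at x. ?r x z < p)" for x
      by (rule frequently_cong[of "\<lambda>z. z \<noteq> x"])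
        (auto simp only: eventually_at_filter slope shift simp_thms eventually_True imp_disjL intro!: always_eventually)
    show ?thesis using neg unfolding up down pq(1) by (simp add: conj_commute)
  qed
  have "negligible (?Z \<union> (\<Union>pq\<in>?I. ?E pq))"
    using cnt E by (intro negligible_Un negligible_unbounded_slopes[OF var] negligible_countable_Union) auto
  then show ?thesis
  proof (rule negligible_subset, intro subsetI)
    fix x assume x: "x \<in> {x \<in> {a<..<b}. \<not> f differentiable (at x)}"
    show "x \<in> ?Z \<union> (\<Union>pq\<in>?I. ?E pq)"
    proof (rule ccontr)
      assume "x \<notin> ?Z \<union> (\<Union>pq\<in>?I. ?E pq)"
      then have "f differentiable (at x)"
        using x by (intro differentiable_if_slopes_settle) auto
      with x show False by simp
    qed
  qed
qed

section \<open>Absolute continuity and the fundamental theorem\<close>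

lemma abs_continuous_on_subset:
  "abs_continuous_on S y \<Longrightarrow> S' \<subseteq> S \<Longrightarrow> abs_continuous_on S' y"
  unfolding abs_continuous_on_def by (meson order_trans)

lemma sum_division_le_measure:
  assumes "D division_of \<Union>D" "\<Union>D \<subseteq> G" "G \<in> lmeasurable"
  shows "(\<Sum>K\<in>D. Sup K - Inf K :: real) \<le> measure lebesgue G"
proof -
  have "((\<lambda>x. 1) has_integral (Sup K - Inf K)) K" if "K \<in> D" for K
  proof -
    obtain u v where "u \<le> v" "K = {u..v}"
      using division_of_real_interval[OF assms(1) \<open>K \<in> D\<close>] by blast
    then show ?thesis using has_integral_const_real[of "1::real" u v] by simp
  qed
  then have "((\<lambda>x. 1) has_integral (\<Sum>K\<in>D. Sup K - Inf K)) (\<Union>D)"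
    by (rule has_integral_combine_division[OF assms(1)])
  moreover have lm: "\<Union>D \<in> lmeasurable"
  proof (rule fmeasurable.finite_Union)
    show "finite D" using assms(1) by auto
    show "D \<subseteq> lmeasurable" using division_ofD(4)[OF assms(1)] by auto
  qed
  ultimately have "(\<Sum>K\<in>D. Sup K - Inf K) = measure lebesgue (\<Union>D)"
    by (simp add: lmeasure_integral integral_unique)
  also have "\<dots> \<le> measure lebesgue G"
    using assms lm by (intro measure_mono_fmeasurable) auto
  finally show ?thesis .
qed

text \<open>The definition with tolerance 1. The bound is kept local, on intervals shorter than
  \<open>\<delta>\<close>: both of its uses, differentiability almost everywhere and absolute
  integrability of the derivative, are local matters.\<close>

lemma abs_continuous_on_variation_bound:
  fixes y :: "real \<Rightarrow> 'a::euclidean_space"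
  assumes "abs_continuous_on {a..b} y"
  obtains \<delta> where "\<delta> > 0"
    "\<And>u v. a \<le> u \<Longrightarrow> v \<le> b \<Longrightarrow> v - u < \<delta> \<Longrightarrow> variation_bound y u v 1"
    "\<And>u v i. a \<le> u \<Longrightarrow> v \<le> b \<Longrightarrow> v - u < \<delta> \<Longrightarrow> i \<in> Basis \<Longrightarrow> variation_bound (\<lambda>s. y s \<bullet> i) u v 1"
proof -
  obtain \<delta> where \<delta>: "\<delta> > 0" and *: "\<And>D. D division_of \<Union>D \<Longrightarrow> \<Union>D \<subseteq> {a..b} \<Longrightarrow>
      (\<Sum>K\<in>D. Sup K - Inf K) < \<delta> \<Longrightarrow> (\<Sum>K\<in>D. norm (y (Sup K) - y (Inf K))) < 1"
    using assms[unfolded abs_continuous_on_def, rule_format, OF zero_less_one] by blast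
  have 1: "variation_bound y u v 1" if uv: "a \<le> u" "v \<le> b" "v - u < \<delta>" for u v
    unfolding variation_bound_def
  proof (intro allI impI)
    fix D assume D: "D division_of \<Union>D \<and> \<Union>D \<subseteq> {u..v}"
    have "(\<Sum>K\<in>D. Sup K - Inf K) \<le> measure lebesgue {u..v}"
      using D by (intro sum_division_le_measure) auto
    also have "\<dots> < \<delta>" using uv \<delta> by (cases "u \<le> v") auto
    finally have "(\<Sum>K\<in>D. Sup K - Inf K) < \<delta>" .
    moreover have "\<Union>D \<subseteq> {a..b}" using D uv by (meson atLeastatMost_subset_iff order_trans)
    ultimately show "(\<Sum>K\<in>D. norm (y (Sup K) - y (Inf K))) \<le> 1" using * D by (meson less_imp_le)
  qed
  have 2: "variation_bound (\<lambda>s. y s \<bullet> i) u v 1"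
    if uv: "a \<le> u" "v \<le> b" "v - u < \<delta>" "i \<in> Basis" for u v i
    unfolding variation_bound_def
  proof (intro allI impI)
    fix D assume D: "D division_of \<Union>D \<and> \<Union>D \<subseteq> {u..v}"
    have "(\<Sum>K\<in>D. norm (y (Sup K) \<bullet> i - y (Inf K) \<bullet> i)) \<le> (\<Sum>K\<in>D. norm (y (Sup K) - y (Inf K)))"
      using uv(4) by (intro sum_mono) (metis Basis_le_norm inner_diff_left real_norm_def)
    also have "\<dots> \<le> 1" using 1[OF uv(1-3)] D by (auto simp: variation_bound_def)
    finally show "(\<Sum>K\<in>D. norm (y (Sup K) \<bullet> i - y (Inf K) \<bullet> i)) \<le> 1" .
  qed
  show thesis using that[OF \<delta> 1 2] .
qed

lemma abs_continuous_on_differentiable_ae: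
  fixes y :: "real \<Rightarrow> 'a::euclidean_space"
  assumes ac: "abs_continuous_on {a..b} y"
  shows "negligible {x \<in> {a<..<b}. \<not> y differentiable (at x)}"
proof -
  obtain \<delta> where \<delta>: "\<delta> > 0" and var:
    "\<And>u v i. a \<le> u \<Longrightarrow> v \<le> b \<Longrightarrow> v - u < \<delta> \<Longrightarrow> i \<in> Basis \<Longrightarrow> variation_bound (\<lambda>s. y s \<bullet> i) u v 1"
    using abs_continuous_on_variation_bound[OF ac] by metis
  let ?S = "{x \<in> {a<..<b}. \<not> y differentiable (at x)}"
  show ?thesis
    unfolding locally_negligible_alt[of ?S]
  proof
    fix x assume x: "x \<in> ?S"
    \<comment> \<open>Reaching at most \<open>\<delta> / 3\<close> to each side keeps the length of
      the window below \<open>\<delta>\<close>.\<close>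
    define u where "u = max a (x - \<delta> / 3)"
    define v where "v = min b (x + \<delta> / 3)"
    have uv: "a \<le> u" "v \<le> b" "v - u < \<delta>" "u < x" "x < v"
      using x \<delta> by (auto simp: u_def v_def)
    have "negligible (\<Union>i\<in>Basis. {x \<in> {u<..<v}. \<not> (\<lambda>s. y s \<bullet> i) differentiable (at x)})"
    proof (intro negligible_Union finite_imageI)
      fix N assume "N \<in> (\<lambda>i. {x \<in> {u<..<v}. \<not> (\<lambda>s. y s \<bullet> i) differentiable (at x)}) ` Basis"
      then show "negligible N" using var[OF uv(1-3)] variation_bound_differentiable_ae by blast
    qed simp
    moreover have "?S \<inter> {u<..<v} \<subseteq> (\<Union>i\<in>Basis. {x \<in> {u<..<v}. \<not> (\<lambda>s. y s \<bullet> i) differentiable (at x)})"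
      using differentiable_componentwise_within[of y _ UNIV] by auto
    ultimately have "negligible (?S \<inter> {u<..<v})" by (rule negligible_subset)
    moreover have "openin (top_of_set ?S) (?S \<inter> {u<..<v})" by (auto intro: openin_open_Int)
    ultimately show "\<exists>U. openin (top_of_set ?S) U \<and> x \<in> U \<and> negligible U"
      using x uv by (intro exI[of _ "?S \<inter> {u<..<v}"]) auto
  qed
qed

text \<open>Comparing both end points with the tag \<open>x\<close> loses nothing: as
  \<open>x\<close> lies between them, the two distances add up to \<open>v - u\<close>.\<close>

lemma straddle_estimate:
  fixes y :: "real \<Rightarrow> 'a::real_normed_vector"
  assumes d: "\<And>z. z \<in> {a..b} \<Longrightarrow> \<bar>z - x\<bar> < d \<Longrightarrow> norm (y z - y x - (z - x) *\<^sub>R h) \<le> e * \<bar>z - x\<bar>"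
    and "x \<in> {u..v}" "{u..v} \<subseteq> {a..b}" "{u..v} \<subseteq> ball x d"
  shows "norm ((v - u) *\<^sub>R h - (y v - y u)) \<le> e * (v - u)"
proof -
  have *: "u \<in> {u..v}" "v \<in> {u..v}" using assms(2) by auto
  have "(v - u) *\<^sub>R h - (y v - y u) = (y u - y x - (u - x) *\<^sub>R h) - (y v - y x - (v - x) *\<^sub>R h)"
    by (simp add: algebra_simps)
  also have "norm \<dots> \<le> norm (y u - y x - (u - x) *\<^sub>R h) + norm (y v - y x - (v - x) *\<^sub>R h)"
    by (rule norm_triangle_ineq4)
  also have "\<dots> \<le> e * \<bar>u - x\<bar> + e * \<bar>v - x\<bar>"
    using * assms(3,4) by (intro add_mono d) (auto simp: dist_real_def subset_iff)
  also have "\<dots> = e * (v - u)" using assms(2) by (auto simp: algebra_simps)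
  finally show ?thesis .
qed

text \<open>The gauge confines the intervals tagged in \<open>N\<close> to an open set of small measure, where absolute
  continuity bounds the increments of \<open>y\<close>.\<close>

theorem abs_continuous_FTC:
  fixes y :: "real \<Rightarrow> 'a::euclidean_space"
  assumes "a \<le> b" and ac: "abs_continuous_on {a..b} y" and N: "negligible N"
    and der: "\<And>x. x \<in> {a..b} - N \<Longrightarrow> (y has_vector_derivative h x) (at x within {a..b})"
  shows "(h has_integral (y b - y a)) {a..b}"
proof -
  \<comment> \<open>With the integrand 0 on \<open>N\<close>, intervals tagged there contribute to
    the error only through increments of \<open>y\<close>.\<close>
  define k where "k x = (if x \<in> N then 0 else h x)" for x
  have "(k has_integral (y b - y a)) {a..b}"
    unfolding has_integral_real
  proof (intro allI impI)
    fix \<epsilon> :: real assume \<epsilon>: "\<epsilon> > 0"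
    \<comment> \<open>Half of \<open>\<epsilon>\<close> is spent on tags outside \<open>N\<close>,
      half on tags in \<open>N\<close>; the summand 1 covers \<open>a = b\<close>.\<close>
    define e where "e = \<epsilon> / (2 * (b - a + 1))"
    have e: "e > 0" "e * (b - a) < \<epsilon> / 2"
      using \<epsilon> assms(1) by (auto simp: e_def field_simps)
    obtain \<delta> where \<delta>: "\<delta> > 0" and ac': "\<And>D. D division_of \<Union>D \<Longrightarrow> \<Union>D \<subseteq> {a..b} \<Longrightarrow>
      (\<Sum>K\<in>D. Sup K - Inf K) < \<delta> \<Longrightarrow> (\<Sum>K\<in>D. norm (y (Sup K) - y (Inf K))) < \<epsilon> / 2"
      using ac[unfolded abs_continuous_on_def, rule_format, of "\<epsilon> / 2"] \<epsilon> by auto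
    obtain G where G: "open G" "N \<subseteq> G" "G - N \<in> lmeasurable" "emeasure lebesgue (G - N) < ennreal \<delta>"
      using sets_lebesgue_outer_open[OF negligible_imp_sets[OF N] \<delta>] by blast
    have "G = (G - N) \<union> N" using G(2) by auto
    then have Gm: "G \<in> lmeasurable"
      using fmeasurable.Un[OF G(3) negligible_imp_measurable[OF N]] by simp
    have "measure lebesgue G = measure lebesgue (G - N)"
      using N Gm by (metis G(3) Diff_Un Un_Diff_cancel2 fmeasurableD measure_Diff_null_set negligible_iff_null_sets)
    then have mG: "measure lebesgue G < \<delta>"
      using G(3,4) \<delta> by (simp add: emeasure_eq_measure2 ennreal_less_iff)
    have "\<exists>d>0. \<forall>z\<in>{a..b}. \<bar>z - x\<bar> < d \<longrightarrow> norm (y z - y x - (z - x) *\<^sub>R h x) \<le> e * \<bar>z - x\<bar>"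
      if "x \<in> {a..b} - N" for x
      using der[OF that] e(1)
      unfolding has_vector_derivative_def has_derivative_within_alt real_norm_def by blast
    then obtain d where d: "\<And>x. x \<in> {a..b} - N \<Longrightarrow> d x > 0"
      "\<And>x z. x \<in> {a..b} - N \<Longrightarrow> z \<in> {a..b} \<Longrightarrow> \<bar>z - x\<bar> < d x \<Longrightarrow>
         norm (y z - y x - (z - x) *\<^sub>R h x) \<le> e * \<bar>z - x\<bar>"
      by metis
    define \<gamma> where "\<gamma> x = (if x \<in> N then G else if x \<in> {a..b} then ball x (d x) else UNIV)" for x
    have gauge: "gauge \<gamma>"
      using G(1,2) d(1) by (auto simp: gauge_def \<gamma>_def)
    have close: "norm ((\<Sum>(x, K)\<in>p. measure lborel K *\<^sub>R k x) - (y b - y a)) < \<epsilon>"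
      if p: "p tagged_division_of {a..b}" "\<gamma> fine p" for p
    proof -
      note pd = tagged_division_ofD[OF p(1)]
      have ivl: "\<exists>u v. u \<le> v \<and> K = {u..v} \<and> x \<in> {u..v}" if "(x, K) \<in> p" for x K
        using pd(2,4)[OF that] by (metis box_real(2) atLeastAtMost_iff order_trans)
      let ?R = "\<lambda>(x, K). measure lborel K *\<^sub>R k x - (y (Sup K) - y (Inf K))"
      define q where "q = {(x, K) \<in> p. x \<in> N}"
      have q: "q \<subseteq> p" "finite q" using pd(1) by (auto simp: q_def intro: finite_subset[of _ p])
      have tele: "(\<Sum>(x, K)\<in>p. y (Sup K) - y (Inf K)) = y b - y a"
        "(\<Sum>(x, K)\<in>p. Sup K - Inf K) = b - a"
        using additive_tagged_division_1[OF assms(1) p(1)] by auto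
      have q_part: "q tagged_partial_division_of {a..b}"
        using p(1) q(1) tagged_partial_division_subset unfolding tagged_division_of_def by blast
      then have div: "snd ` q division_of \<Union>(snd ` q)" by (rule partial_division_of_tagged_division)
      \<comment> \<open>The passage from tagged intervals to intervals requires value 0 on every
        \<open>cbox u v\<close> whose \<open>box u v\<close> is empty. This includes the empty set,
        where \<open>Sup\<close> and \<open>Inf\<close> are unspecified.\<close>
      let ?V = "\<lambda>K. if K = {} then 0 else norm (y (Sup K) - y (Inf K))"
      have "(\<Sum>(x, K)\<in>q. norm (y (Sup K) - y (Inf K))) = (\<Sum>(x, K)\<in>q. ?V K)"
        using q pd(2) by (intro sum.cong) (auto dest!: pd(2)[OF subsetD[OF q(1)]])
      also have "\<dots> = sum ?V (snd ` q)"
      proof (rule sum.over_tagged_division_lemma[OF tagged_partial_division_of_Union_self[OF q_part]])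
        fix u v :: real assume "box u v = {}"
        then show "?V (cbox u v) = 0" by (cases "u = v") auto
      qed
      also have "\<dots> = (\<Sum>K\<in>snd ` q. norm (y (Sup K) - y (Inf K)))"
        using division_ofD(3)[OF div] by (intro sum.cong) auto
      also have "\<dots> < \<epsilon> / 2"
      proof (rule ac'[OF div])
        show "\<Union>(snd ` q) \<subseteq> {a..b}" using q(1) pd(3) by fastforce
        have "\<Union>(snd ` q) \<subseteq> G"
          using p(2) q(1) unfolding fine_def by (fastforce simp: q_def \<gamma>_def)
        then have "(\<Sum>K\<in>snd ` q. Sup K - Inf K) \<le> measure lebesgue G"
          by (rule sum_division_le_measure[OF div _ Gm])
        with mG show "(\<Sum>K\<in>snd ` q. Sup K - Inf K) < \<delta>" by linarith
      qed
      finally have small: "(\<Sum>(x, K)\<in>q. norm (y (Sup K) - y (Inf K))) < \<epsilon> / 2" .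
      have "(\<Sum>(x, K)\<in>p. measure lborel K *\<^sub>R k x) - (y b - y a) = sum ?R p"
        unfolding tele(1)[symmetric] by (simp add: sum_subtractf split_def)
      also have "norm \<dots> \<le> (\<Sum>i\<in>p. norm (?R i))" by (rule norm_sum)
      also have "\<dots> = (\<Sum>i\<in>q. norm (?R i)) + (\<Sum>i\<in>p - q. norm (?R i))"
        using q pd(1) by (simp add: sum.subset_diff[of q p] add.commute)
      also have "(\<Sum>i\<in>q. norm (?R i)) = (\<Sum>(x, K)\<in>q. norm (y (Sup K) - y (Inf K)))"
        by (intro sum.cong) (auto simp: q_def k_def norm_minus_commute)
      also have "(\<Sum>i\<in>p - q. norm (?R i)) \<le> (\<Sum>(x, K)\<in>p - q. e * (Sup K - Inf K))"
      proof (rule sum_mono)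
        fix i assume i: "i \<in> p - q"
        obtain x K where xK: "i = (x, K)" by fastforce
        with i have mem: "(x, K) \<in> p" "x \<notin> N" by (auto simp: q_def)
        obtain u v where uv: "u \<le> v" "K = {u..v}" "x \<in> {u..v}" using ivl[OF mem(1)] by blast
        have sub: "{u..v} \<subseteq> {a..b}" using pd(3)[OF mem(1)] uv by simp
        then have x: "x \<in> {a..b} - N" using uv(3) mem by blast
        have "{u..v} \<subseteq> \<gamma> x" using p(2) mem(1) uv(2) unfolding fine_def by blast
        then have "{u..v} \<subseteq> ball x (d x)" using x by (simp add: \<gamma>_def)
        then have "norm ((v - u) *\<^sub>R h x - (y v - y u)) \<le> e * (v - u)"
          using straddle_estimate[of a b x "d x" y "h x" e u v] d(2)[OF x] uv sub by blast
        then show "norm (?R i) \<le> (case i of (x, K) \<Rightarrow> e * (Sup K - Inf K))"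
          using uv mem by (simp add: xK k_def)
      qed
      also have "\<dots> \<le> (\<Sum>(x, K)\<in>p. e * (Sup K - Inf K))"
        using pd(1) e(1) ivl by (intro sum_mono2) fastforce+
      also have "\<dots> = e * (b - a)"
        unfolding tele(2)[symmetric] by (simp add: sum_distrib_left split_def)
      finally show ?thesis using small e(2) by linarith
    qed
    show "\<exists>\<gamma>. gauge \<gamma> \<and> (\<forall>p. p tagged_division_of {a..b} \<and> \<gamma> fine p \<longrightarrow>
        norm ((\<Sum>(x, K)\<in>p. measure lborel K *\<^sub>R k x) - (y b - y a)) < \<epsilon>)"
      by (intro exI[of _ \<gamma>] conjI gauge allI impI) (elim conjE, rule close)
  qed
  then show ?thesis
    by (rule has_integral_spike[OF N, rotated]) (auto simp: k_def)
qed

text \<open>Integrals of \<open>h\<close> over subintervals are increments of \<open>y\<close>, so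
  the variation bound on short intervals bounds the sums of norms of integrals and gives absolute
  integrability there. Integrability of the norm then extends from short intervals to
  \<open>{a..b}\<close>.\<close>

lemma abs_continuous_derivative:
  fixes y :: "real \<Rightarrow> 'a::euclidean_space"
  assumes "a < b" and ac: "abs_continuous_on {a..b} y"
  defines "h \<equiv> \<lambda>s. vector_derivative y (at s within {a..b})"
  shows "(h has_integral (y b - y a)) {a..b}" "h absolutely_integrable_on {a..b}"
proof -
  define N where "N = {a, b} \<union> {x \<in> {a<..<b}. \<not> y differentiable (at x)}"
  have N: "negligible N" unfolding N_def
    by (intro negligible_Un abs_continuous_on_differentiable_ae[OF ac]) auto
  have der: "(y has_vector_derivative h x) (at x within {a..b})" if "x \<in> {a..b} - N" for x
  proof -
    have "y differentiable (at x within {a..b})"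
      using that by (auto simp: N_def intro: differentiable_at_withinI)
    then show ?thesis by (simp add: h_def vector_derivative_works)
  qed
  have int: "(h has_integral (y v - y u)) {u..v}" if uv: "a \<le> u" "u \<le> v" "v \<le> b" for u v
  proof (rule abs_continuous_FTC[OF uv(2) abs_continuous_on_subset[OF ac] N])
    show "{u..v} \<subseteq> {a..b}" using uv by auto
    show "(y has_vector_derivative h x) (at x within {u..v})" if "x \<in> {u..v} - N" for x
      using der[of x] that uv by (intro has_vector_derivative_within_subset[OF der]) auto
  qed
  show I: "(h has_integral (y b - y a)) {a..b}" using int[of a b] assms(1) by simp
  obtain \<delta> where \<delta>: "\<delta> > 0" and var: "\<And>u v. a \<le> u \<Longrightarrow> v \<le> b \<Longrightarrow> v - u < \<delta> \<Longrightarrow> variation_bound y u v 1"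
    using abs_continuous_on_variation_bound[OF ac] by metis
  have small: "h absolutely_integrable_on {u..v}"
    if uv: "a \<le> u" "u \<le> v" "v \<le> b" "v - u < \<delta>" for u v
    unfolding box_real[symmetric]
  proof (rule bounded_variation_absolutely_integrable_interval)
    show "h integrable_on cbox u v" using int[OF uv(1-3)] by auto
    fix D assume D: "D division_of cbox u v"
    have "norm (integral K h) = norm (y (Sup K) - y (Inf K))" if "K \<in> D" for K
    proof -
      obtain p q where pq: "p \<le> q" "K = {p..q}"
        using division_of_real_interval[OF D \<open>K \<in> D\<close>] by blast
      have "K \<subseteq> {u..v}" using division_ofD(2)[OF D \<open>K \<in> D\<close>] by simp
      then have "u \<le> p" "q \<le> v" using pq by auto
      then have "integral K h = y q - y p"
        using int[of p q] uv pq by (auto intro: integral_unique)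
      then show ?thesis using pq by simp
    qed
    then have "(\<Sum>K\<in>D. norm (integral K h)) = (\<Sum>K\<in>D. norm (y (Sup K) - y (Inf K)))" by simp
    also have "\<dots> \<le> 1"
      using var[of u v] uv D division_ofD(6)[OF D] unfolding variation_bound_def by auto
    finally show "(\<Sum>K\<in>D. norm (integral K h)) \<le> 1" .
  qed
  have "(\<lambda>x. norm (h x)) integrable_on cbox a b"
  proof (rule integrable_on_little_subintervals, intro ballI exI conjI allI impI)
    fix x u v assume "x \<in> cbox u v \<and> cbox u v \<subseteq> ball x (\<delta> / 2) \<and> cbox u v \<subseteq> cbox a b"
    then have *: "x \<in> {u..v}" "{u..v} \<subseteq> ball x (\<delta> / 2)" "{u..v} \<subseteq> {a..b}" by auto
    then have "u \<in> ball x (\<delta> / 2)" "v \<in> ball x (\<delta> / 2)" by (auto simp: subset_iff)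
    then have "v - u < \<delta>" using *(1) by (auto simp: dist_real_def)
    moreover have "a \<le> u" "u \<le> v" "v \<le> b" using *(1,3) by auto
    ultimately have "h absolutely_integrable_on {u..v}" by (rule small[rotated 3])
    then show "(\<lambda>x. norm (h x)) integrable_on cbox u v"
      by (simp add: absolutely_integrable_on_def)
  qed (use \<delta> in auto)
  then show "h absolutely_integrable_on {a..b}" using I by (auto simp: absolutely_integrable_on_def)
qed

section \<open>Superlinear convex Lagrangians\<close>

lemma grad_eqI: "GDERIV f x :> D \<Longrightarrow> grad f x = D"
  unfolding grad_def
proof (rule the_equality)
  fix D' assume "GDERIV f x :> D" "GDERIV f x :> D'"
  then have "(\<lambda>h. h \<bullet> D) = (\<lambda>h. h \<bullet> D')"
    unfolding gderiv_def by (rule has_derivative_unique)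
  then have "(D - D') \<bullet> D = (D - D') \<bullet> D'" by meson
  then have "(D - D') \<bullet> (D - D') = 0" by (simp add: inner_diff_right)
  then show "D' = D" by simp
qed

lemma C2_grad:
  fixes f :: "'a::euclidean_space \<Rightarrow> real"
  assumes "C2 f"
  shows "GDERIV f x :> grad f x" "continuous_on UNIV (grad f)"
proof -
  obtain f' f'' where f': "\<And>x. (f has_derivative blinfun_apply (f' x)) (at x)"
    and f'': "\<And>x. (f' has_derivative blinfun_apply (f'' x)) (at x)"
    using assms unfolding C2_def by blast
  have eq: "blinfun_apply (f' x) = (\<lambda>h. h \<bullet> (\<Sum>b\<in>Basis. f' x b *\<^sub>R b))" for x
  proof
    fix h
    have "blinfun_apply (f' x) h = blinfun_apply (f' x) (\<Sum>b\<in>Basis. (h \<bullet> b) *\<^sub>R b)"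
      by (simp add: euclidean_representation)
    also have "\<dots> = h \<bullet> (\<Sum>b\<in>Basis. f' x b *\<^sub>R b)"
      by (simp add: blinfun.sum_right blinfun.scaleR_right inner_sum_right mult.commute)
    finally show "blinfun_apply (f' x) h = h \<bullet> (\<Sum>b\<in>Basis. f' x b *\<^sub>R b)" .
  qed
  have D: "GDERIV f x :> (\<Sum>b\<in>Basis. f' x b *\<^sub>R b)" for x
    using f'[of x] eq[of x] by (simp add: gderiv_def)
  show "GDERIV f x :> grad f x" using D grad_eqI[OF D] by simp
  have "continuous_on UNIV f'"
    using f'' by (intro has_derivative_continuous_on) (auto intro: has_derivative_at_withinI)
  then show "continuous_on UNIV (grad f)"
    unfolding grad_eqI[OF D] by (intro continuous_intros)
qed

locale superlinear_convex =
  fixes l :: "'a::euclidean_space \<Rightarrow> real"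
  assumes C2: "C2 l" and strict: "strictly_convex l"
    and superlinear: "filterlim (\<lambda>u. l u / norm u) at_top at_infinity"
begin

lemma l_deriv: "(l has_derivative (\<lambda>h. grad l u \<bullet> h)) (at u)"
  using C2_grad(1)[OF C2, of u] by (simp add: gderiv_def inner_commute)

lemma continuous_l: "continuous_on S l"
  using l_deriv by (intro has_derivative_continuous_on) (auto intro: has_derivative_at_withinI)

lemma continuous_grad: "continuous_on S (grad l)"
  using C2_grad(2)[OF C2] continuous_on_subset by blast

lemma l_along_line:
  "((\<lambda>\<theta>. l (u + \<theta> *\<^sub>R h)) has_real_derivative grad l (u + \<theta> *\<^sub>R h) \<bullet> h) (at \<theta> within S)"
proof -
  have "((\<lambda>\<theta>. u + \<theta> *\<^sub>R h) has_derivative (\<lambda>\<theta>. \<theta> *\<^sub>R h)) (at \<theta> within S)"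
    by (auto intro!: derivative_eq_intros)
  from has_derivative_compose[OF this l_deriv] show ?thesis
    by (simp add: has_field_derivative_def mult_commute_abs)
qed

text \<open>By convexity the slope from \<open>u\<close> along the segment is at most
  \<open>l v - l u\<close>, and it tends to the directional derivative at \<open>u\<close>.\<close>

lemma gradient_le: "l u + grad l u \<bullet> (v - u) \<le> l v"
proof (cases "u = v")
  case False
  have lim: "((\<lambda>\<theta>. (l (u + \<theta> *\<^sub>R (v - u)) - l u) / \<theta>) \<longlongrightarrow> grad l u \<bullet> (v - u)) (at 0 within {0<..})"
    using l_along_line[of u "v - u" 0 "{0<..}"] by (simp add: has_field_derivative_iff)
  have ev: "\<forall>\<^sub>F \<theta> in at 0 within {0<..}. (l (u + \<theta> *\<^sub>R (v - u)) - l u) / \<theta> \<le> l v - l u"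
    unfolding eventually_at
  proof (intro exI[of _ 1] conjI ballI impI)
    fix \<theta> :: real assume "\<theta> \<in> {0<..}" "\<theta> \<noteq> 0 \<and> dist \<theta> 0 < 1"
    then have \<theta>: "0 < \<theta>" "\<theta> < 1" by auto
    have "u + \<theta> *\<^sub>R (v - u) = (1 - \<theta>) *\<^sub>R u + \<theta> *\<^sub>R v" by (simp add: algebra_simps)
    then have "l (u + \<theta> *\<^sub>R (v - u)) < (1 - \<theta>) * l u + \<theta> * l v"
      using strict False \<theta> by (simp add: strictly_convex_def)
    then show "(l (u + \<theta> *\<^sub>R (v - u)) - l u) / \<theta> \<le> l v - l u"
      using \<theta> by (simp add: field_simps)
  qed simp
  have "grad l u \<bullet> (v - u) \<le> l v - l u"
    by (rule tendsto_upperbound[OF lim ev]) simp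
  then show ?thesis by simp
qed simp

text \<open>The limit in \<open>gradient_le\<close> loses strictness. The midpoint restores it:
  there \<open>l\<close> is strictly below the chord but not below the tangent plane.\<close>

lemma gradient_less:
  assumes "u \<noteq> v"
  shows "l u + grad l u \<bullet> (v - u) < l v"
proof -
  define m where "m = (1 - 1/2) *\<^sub>R u + (1/2) *\<^sub>R v"
  have "l m < (1 - 1/2) * l u + (1/2) * l v"
    unfolding m_def by (rule strict[unfolded strictly_convex_def, rule_format, OF assms]) auto
  moreover have "l u + grad l u \<bullet> (m - u) \<le> l m" by (rule gradient_le)
  moreover have "m - u = (1/2) *\<^sub>R (v - u)"
    by (simp add: m_def algebra_simps flip: scaleR_left.add)
  ultimately show ?thesis by simp
qed

lemma superlinear_bound: obtains C where "C \<ge> 0" "\<And>u. R * norm u - C \<le> l u"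
proof -
  have "\<forall>\<^sub>F u in at_infinity. l u / norm u \<ge> R" using superlinear by (simp add: filterlim_at_top)
  then obtain B where B: "\<And>u. norm u \<ge> B \<Longrightarrow> l u / norm u \<ge> R"
    by (auto simp: eventually_at_infinity)
  have "continuous_on (cball 0 (max B 1)) (\<lambda>u. R * norm u - l u)"
    by (intro continuous_intros continuous_l)
  then obtain C where C: "\<And>u. u \<in> cball 0 (max B 1) \<Longrightarrow> R * norm u - l u \<le> C"
    using continuous_attains_sup[of "cball 0 (max B 1)" "\<lambda>u. R * norm u - l u"] by fastforce
  show thesis
  proof
    fix u
    show "R * norm u - max C 0 \<le> l u"
    proof (cases "norm u \<le> max B 1")
      case True
      with C[of u] show ?thesis by simp
    next
      case False
      then have "l u / norm u \<ge> R" "norm u > 0" using B[of u] by auto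
      then have "R * norm u \<le> l u" by (simp add: pos_le_divide_eq)
      then show ?thesis by simp
    qed
  qed simp
qed

lemma attains_min:
  fixes f :: "'a \<Rightarrow> real"
  assumes "continuous_on UNIV f" "\<And>u. norm u - C \<le> f u"
  obtains u where "\<And>v. f u \<le> f v"
proof -
  \<comment> \<open>Outside this ball the growth bound forces \<open>f\<close> above
    \<open>f 0\<close>, so a minimizer on the compact ball is global.\<close>
  let ?B = "cball 0 (max 0 (f 0 + C))"
  have "continuous_on ?B f" using assms(1) continuous_on_subset by blast
  then obtain u where u: "u \<in> ?B" "\<And>v. v \<in> ?B \<Longrightarrow> f u \<le> f v"
    using continuous_attains_inf[of ?B f] by auto
  have "f u \<le> f v" for v
  proof (cases "v \<in> ?B")
    case False
    then have "f 0 \<le> f v" using assms(2)[of v] by simp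
    moreover have "f u \<le> f 0" using u(2)[of 0] by simp
    ultimately show ?thesis by simp
  qed (use u in auto)
  then show thesis by (rule that)
qed

text \<open>Adding the two strict gradient inequalities excludes two points with one gradient. For
  surjectivity, a minimizer of \<open>l u - p \<bullet> u\<close> has gradient \<open>p\<close>;
  growth of \<open>l\<close> with slope \<open>norm p + 1\<close> leaves slope 1 for
  coercivity.\<close>

lemma bij_grad: "bij (grad l)"
proof (rule bijI)
  show "inj (grad l)"
  proof (rule injI, rule ccontr)
    fix u v assume eq: "grad l u = grad l v" and "u \<noteq> v"
    then show False
      using gradient_less[of u v] gradient_less[of v u] by (simp add: inner_diff_right)
  qed
  have "\<exists>u. grad l u = p" for p
  proof -
    obtain C where C: "C \<ge> 0" "\<And>u. (norm p + 1) * norm u - C \<le> l u"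
      using superlinear_bound[of "norm p + 1"] by blast
    have "norm u - C \<le> l u - p \<bullet> u" for u
      using C(2)[of u] norm_cauchy_schwarz[of p u] by (simp add: algebra_simps)
    moreover have "continuous_on UNIV (\<lambda>u. l u - p \<bullet> u)" by (intro continuous_intros continuous_l)
    ultimately obtain u where u: "\<And>v. l u - p \<bullet> u \<le> l v - p \<bullet> v"
      using attains_min[of "\<lambda>u. l u - p \<bullet> u" C] by blast
    have "((\<lambda>u. l u - p \<bullet> u) has_derivative (\<lambda>h. grad l u \<bullet> h - p \<bullet> h)) (at u)"
      by (auto intro!: derivative_eq_intros l_deriv)
    then have "(\<lambda>h. grad l u \<bullet> h - p \<bullet> h) = (\<lambda>h. 0)"
      by (rule has_derivative_local_min) (simp add: u)
    then have "(grad l u - p) \<bullet> (grad l u - p) = 0" by (metis inner_diff_left)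
    then show ?thesis by auto
  qed
  then show "surj (grad l)" by (metis surjI)
qed

section \<open>Inverse gradient and Legendre transform\<close>

definition "\<iota> = inv (grad l)"

lemma grad_\<iota> [simp]: "grad l (\<iota> p) = p"
  unfolding \<iota>_def by (rule surj_f_inv_f[OF bij_is_surj[OF bij_grad]])

lemma \<iota>_grad [simp]: "\<iota> (grad l u) = u"
  unfolding \<iota>_def by (rule inv_f_f[OF bij_is_inj[OF bij_grad]])

text \<open>Invariance of domain gives continuity even where the Hessian of \<open>l\<close> is
  singular and the inverse function theorem fails.\<close>

lemma continuous_\<iota>: "continuous_on S \<iota>"
proof -
  have "\<forall>u\<in>UNIV. \<iota> (grad l u) = u" by simp
  then have "continuous_on (grad l ` UNIV) \<iota>"
    using bij_is_inj[OF bij_grad]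
    by (intro continuous_on_inverse_open[OF open_UNIV continuous_grad]) auto
  then show ?thesis
    using bij_is_surj[OF bij_grad] continuous_on_subset[of UNIV \<iota> S] by simp
qed

lemma legendre_at: "legendre l p = p \<bullet> \<iota> p - l (\<iota> p)"
  unfolding legendre_def
proof (rule cSup_eq_maximum)
  fix z assume "z \<in> range (\<lambda>u. p \<bullet> u - l u)"
  then obtain u where "z = p \<bullet> u - l u" by auto
  then show "z \<le> p \<bullet> \<iota> p - l (\<iota> p)"
    using gradient_le[of "\<iota> p" u] by (simp add: inner_diff_right)
qed auto

lemma legendre_ge: "p \<bullet> u - l u \<le> legendre l p"
  unfolding legendre_at using gradient_le[of "\<iota> p" u] by (simp add: inner_diff_right)

lemma continuous_legendre: "continuous_on S (legendre l)"
  unfolding legendre_at[abs_def] by (intro continuous_intros continuous_\<iota> continuous_on_compose2[OF continuous_l]) auto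

text \<open>A finite continuous function has a superlinear conjugate: the supremum is tested at the
  vector of length \<open>\<bar>R\<bar>\<close> along \<open>p\<close>, signed by \<open>R\<close>,
  and \<open>l\<close> is bounded on the ball of that radius.\<close>

lemma legendre_bound: obtains C where "C \<ge> 0" "\<And>p. R * norm p - C \<le> legendre l p"
proof -
  obtain C where C: "\<And>u. u \<in> cball 0 \<bar>R\<bar> \<Longrightarrow> l u \<le> C"
    using continuous_attains_sup[of "cball 0 \<bar>R\<bar>" l] continuous_l by fastforce
  show thesis
  proof
    fix p :: 'a
    let ?u = "R *\<^sub>R sgn p"
    have "norm ?u \<le> \<bar>R\<bar>" by (simp add: norm_sgn)
    then have "l ?u \<le> C" using C by simp
    moreover have "p \<bullet> ?u = R * norm p"
      by (cases "p = 0") (auto simp: sgn_div_norm dot_square_norm power2_eq_square)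
    ultimately show "R * norm p - max C 0 \<le> legendre l p" using legendre_ge[of p ?u] by linarith
  qed simp
qed

end

section \<open>Value and minimizers of the discounted problem\<close>

text \<open>The cost and \<open>Vfun\<close> are Lebesgue integrals, while the estimates below use
  gauge integrals.\<close>

lemma continuous_LINT:
  fixes f :: "real \<Rightarrow> 'b::euclidean_space"
  assumes "continuous_on {a..b} f"
  shows "(LINT s:{a..b}|lebesgue. f s) = integral {a..b} f"
  using absolutely_integrable_continuous_real[OF assms] by (rule set_lebesgue_integral_eq_integral(2))

lemma abs_continuous_on_indefinite_integral:
  fixes u :: "real \<Rightarrow> 'b::euclidean_space"
  assumes "continuous_on {a..b} u"
  shows "abs_continuous_on {a..b} (\<lambda>s. x + integral {a..s} u)"
  unfolding abs_continuous_on_def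
proof (intro allI impI)
  fix \<epsilon> :: real assume \<epsilon>: "\<epsilon> > 0"
  have "bounded (u ` {a..b})" using assms by (intro compact_imp_bounded compact_continuous_image) auto
  then obtain M where M: "M > 0" "\<And>s. s \<in> {a..b} \<Longrightarrow> norm (u s) \<le> M"
    unfolding bounded_pos by auto
  have lip: "norm (integral {a..q} u - integral {a..p} u) \<le> M * (q - p)"
    if "a \<le> p" "p \<le> q" "q \<le> b" for p q
  proof -
    have int: "u integrable_on {a..q}" "u integrable_on {p..q}"
      using that assms by (auto intro!: integrable_continuous_real intro: continuous_on_subset)
    have "integral {a..p} u + integral {p..q} u = integral {a..q} u"
      using that int(1) by (intro Henstock_Kurzweil_Integration.integral_combine) auto
    then have "integral {a..q} u - integral {a..p} u = integral {p..q} u" by (simp add: algebra_simps)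
    moreover have "norm (integral {p..q} u) \<le> M * (q - p)"
      using integral_bound[of p q u M] that M(2) assms continuous_on_subset[OF assms, of "{p..q}"] by auto
    ultimately show ?thesis by simp
  qed
  show "\<exists>\<delta>>0. \<forall>D. D division_of \<Union> D \<and> \<Union> D \<subseteq> {a..b} \<and> (\<Sum>K\<in>D. Sup K - Inf K) < \<delta> \<longrightarrow>
      (\<Sum>K\<in>D. norm (x + integral {a..Sup K} u - (x + integral {a..Inf K} u))) < \<epsilon>"
  proof (intro exI[of _ "\<epsilon> / M"] conjI allI impI)
    show "\<epsilon> / M > 0" using \<epsilon> M by simp
    fix D assume D: "D division_of \<Union> D \<and> \<Union> D \<subseteq> {a..b} \<and> (\<Sum>K\<in>D. Sup K - Inf K) < \<epsilon> / M"
    have "(\<Sum>K\<in>D. norm (x + integral {a..Sup K} u - (x + integral {a..Inf K} u)))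
        \<le> (\<Sum>K\<in>D. M * (Sup K - Inf K))"
    proof (rule sum_mono)
      fix K assume K: "K \<in> D"
      then obtain p q where pq: "p \<le> q" "K = {p..q}" using division_of_real_interval D by blast
      have "K \<subseteq> {a..b}" using K D by blast
      then show "norm (x + integral {a..Sup K} u - (x + integral {a..Inf K} u)) \<le> M * (Sup K - Inf K)"
        using lip[of p q] pq by simp
    qed
    also have "\<dots> = M * (\<Sum>K\<in>D. Sup K - Inf K)" by (simp only: sum_distrib_left)
    also have "\<dots> < \<epsilon>" using D M(1) by (simp only: pos_less_divide_eq mult.commute)
    finally show "(\<Sum>K\<in>D. norm (x + integral {a..Sup K} u - (x + integral {a..Inf K} u))) < \<epsilon>" .
  qed
qed

locale discounted_problem = superlinear_convex l
  for l :: "'a::euclidean_space \<Rightarrow> real" +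
  fixes g :: "'a \<Rightarrow> real" and d :: "real \<Rightarrow> real \<Rightarrow> real" and T a :: real
  assumes g_lipschitz: "\<exists>L. L-lipschitz_on UNIV g"
    and a_pos: "a > 0"
    and d_range: "\<And>t s. t \<in> {0..T} \<Longrightarrow> s \<in> {0..T} \<Longrightarrow> d t s \<in> {a<..1}"
    and d_lipschitz: "\<exists>L. L-lipschitz_on ({0..T} \<times> {0..T}) (\<lambda>(t, s). d t s)"
    and d_diag: "\<And>t. t \<in> {0..T} \<Longrightarrow> d t t = 1"
begin

section \<open>Extremal controls\<close>

lemma d_bounds:
  assumes "t \<in> {0..T}" "s \<in> {0..T}"
  shows "a < d t s" "0 < d t s" "d t s \<le> 1"
  using d_range[OF assms] a_pos by auto

lemma continuous_d:
  assumes "t \<in> {0..T}" "S \<subseteq> {0..T}"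
  shows "continuous_on S (d t)"
proof -
  obtain L where "L-lipschitz_on ({0..T} \<times> {0..T}) (\<lambda>(t, s). d t s)" using d_lipschitz by blast
  then have cont: "continuous_on ({0..T} \<times> {0..T}) (\<lambda>(t, s). d t s)" by (rule lipschitz_on_continuous_on)
  have "continuous_on S (Pair t)" by (intro continuous_intros)
  then have "continuous_on S (\<lambda>s. case (t, s) of (t, s) \<Rightarrow> d t s)"
    by (rule continuous_on_compose2[OF cont]) (use assms in auto)
  then show ?thesis by simp
qed

lemma ctrl_eq: "ctrl d l t \<beta> s = \<iota> ((1 / d t s) *\<^sub>R grad l \<beta>)"
  by (simp add: ctrl_def \<iota>_def)

text \<open>The Euler-Lagrange equation: the discounted momentum is constant in time. Hence gradient
  inequalities along an extremal integrate to statements about its end points.\<close>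

lemma grad_ctrl:
  assumes "t \<in> {0..T}" "s \<in> {0..T}"
  shows "d t s *\<^sub>R grad l (ctrl d l t \<beta> s) = grad l \<beta>"
  using d_bounds[OF assms] by (simp add: ctrl_eq)

lemma continuous_ctrl:
  assumes "t \<in> {0..T}" "S \<subseteq> {0..T}"
  shows "continuous_on S (ctrl d l t \<beta>)"
proof -
  have "continuous_on S (\<lambda>s. (1 / d t s) *\<^sub>R grad l \<beta>)"
    using assms d_bounds(2) by (intro continuous_intros continuous_d) fastforce+
  then show ?thesis unfolding ctrl_eq[abs_def]
    by (rule continuous_on_compose2[OF continuous_\<iota>[of UNIV]]) auto
qed

lemma continuous_cost:
  assumes "t \<in> {0..T}" "S \<subseteq> {0..T}" "continuous_on S u"
  shows "continuous_on S (\<lambda>s. d t s * l (u s))"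
  using assms by (intro continuous_intros continuous_d continuous_on_compose2[OF continuous_l[of UNIV]]) auto

lemma Vfun_eq:
  assumes "t \<in> {0..T}"
  shows "Vfun T d l g x t \<beta> = integral {t..T} (\<lambda>s. d t s * l (ctrl d l t \<beta> s))
    + d t T * g (x + integral {t..T} (ctrl d l t \<beta>))"
proof -
  have sub: "{t..T} \<subseteq> {0..T}" using assms by auto
  show ?thesis unfolding Vfun_def traj_def
    using assms sub by (simp add: continuous_LINT continuous_ctrl continuous_cost)
qed

text \<open>With \<open>p = grad l \<beta>\<close>, the equation is the stationarity condition of the coercive convex function
  \<open>p \<mapsto> \<integral> d\<^sub>t(s) l\<^sup>*(p / d\<^sub>t(s)) ds - p \<cdot> c\<close>.\<close>

lemma ctrl_reaches:
  assumes t: "0 \<le> t" "t < T"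
  obtains \<beta> where "integral {t..T} (ctrl d l t \<beta>) = c"
proof -
  have tT: "t \<in> {0..T}" and sub: "{t..T} \<subseteq> {0..T}" using t by auto
  define F where "F p = integral {t..T} (\<lambda>s. \<iota> ((1 / d t s) *\<^sub>R p))" for p
  define H where "H p = integral {t..T} (\<lambda>s. d t s * legendre l ((1 / d t s) *\<^sub>R p)) - p \<bullet> c" for p
  have dne: "d t s \<noteq> 0" if "s \<in> {t..T}" for s using d_bounds(2)[OF tT] that sub by fastforce
  have dc: "continuous_on S (\<lambda>x. d t (snd x))" if "snd ` S \<subseteq> {t..T}" for S :: "('a \<times> real) set"
    using that by (intro continuous_on_compose2[OF continuous_d[OF tT sub]] continuous_intros) auto
  have c1: "continuous_on (UNIV \<times> {t..T}) (\<lambda>(p :: 'a, s). (1 / d t s) *\<^sub>R p)"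
    unfolding split_def
  proof (rule continuous_on_scaleR[OF continuous_on_divide[OF continuous_on_const dc]])
    show "continuous_on (UNIV \<times> {t..T}) (fst :: 'a \<times> real \<Rightarrow> 'a)" by (intro continuous_intros)
  qed (use dne in auto)
  have c\<iota>: "continuous_on (UNIV \<times> cbox t T) (\<lambda>(p, s). \<iota> ((1 / d t s) *\<^sub>R p))"
    using continuous_on_compose2[OF continuous_\<iota>[of UNIV] c1] by (simp add: split_def)
  have cL: "continuous_on (UNIV \<times> cbox t T) (\<lambda>(p, s). d t s * legendre l ((1 / d t s) *\<^sub>R p))"
    using continuous_on_compose2[OF continuous_legendre[of UNIV] c1]
    unfolding split_def by (intro continuous_intros dc) auto
  have contF: "continuous_on UNIV F"
    using integral_continuous_on_param[OF c\<iota>] by (simp add: F_def[abs_def])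
  have contH: "continuous_on UNIV H"
    using integral_continuous_on_param[OF cL] unfolding H_def[abs_def]
    by (intro continuous_intros) simp
  have slice: "(f p) integrable_on {t..T}"
    if "continuous_on (UNIV \<times> cbox t T) (\<lambda>(p, s). f p s)" for f :: "'a \<Rightarrow> real \<Rightarrow> 'b::banach" and p
  proof (rule integrable_continuous_real)
    have "continuous_on {t..T} (Pair p)" by (intro continuous_intros)
    then have "continuous_on {t..T} (\<lambda>s. case (p, s) of (p, s) \<Rightarrow> f p s)"
      by (rule continuous_on_compose2[OF that]) auto
    then show "continuous_on {t..T} (f p)" by simp
  qed
  note i\<iota> = slice[OF c\<iota>] and iL = slice[OF cL]
  \<comment> \<open>\<open>F p - c\<close> is a subgradient of \<open>H\<close> at \<open>p\<close>.
    This, with continuity of \<open>F\<close>, replaces differentiation of \<open>H\<close> under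
    the integral.\<close>
  have sub_grad: "H p + (F p - c) \<bullet> (q - p) \<le> H q" for p q
  proof -
    have ii: "(\<lambda>s. (q - p) \<bullet> \<iota> ((1 / d t s) *\<^sub>R p)) integrable_on {t..T}"
      "integral {t..T} (\<lambda>s. (q - p) \<bullet> \<iota> ((1 / d t s) *\<^sub>R p)) = (q - p) \<bullet> F p"
      using integrable_linear[OF i\<iota> bounded_linear_inner_right, of "q - p" p]
        integral_linear[OF i\<iota> bounded_linear_inner_right, of "q - p" p]
      by (simp_all add: o_def F_def)
    have "integral {t..T} (\<lambda>s. d t s * legendre l ((1 / d t s) *\<^sub>R p) + (q - p) \<bullet> \<iota> ((1 / d t s) *\<^sub>R p))
        \<le> integral {t..T} (\<lambda>s. d t s * legendre l ((1 / d t s) *\<^sub>R q))"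
    proof (intro integral_le integrable_add iL ii)
      fix s assume s: "s \<in> {t..T}"
      let ?p = "(1 / d t s) *\<^sub>R p" and ?q = "(1 / d t s) *\<^sub>R q"
      have pos: "0 < d t s" using d_bounds(2)[OF tT] s sub by blast
      have "legendre l ?p + (?q - ?p) \<bullet> \<iota> ?p \<le> legendre l ?q"
        using legendre_ge[of ?q "\<iota> ?p"] by (simp add: legendre_at[of ?p] inner_diff_left)
      then have "d t s * (legendre l ?p + (?q - ?p) \<bullet> \<iota> ?p) \<le> d t s * legendre l ?q"
        using pos by (intro mult_left_mono) auto
      moreover have "d t s * ((?q - ?p) \<bullet> \<iota> ?p) = (q - p) \<bullet> \<iota> ?p"
        using pos by (simp flip: scaleR_diff_right)
      ultimately show "d t s * legendre l ?p + (q - p) \<bullet> \<iota> ?p \<le> d t s * legendre l ?q"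
        by (simp only: distrib_left)
    qed
    then show ?thesis
      using integral_add[OF iL[of p] ii(1)] ii(2)
      by (simp add: H_def inner_diff_left inner_diff_right inner_commute)
  qed
  \<comment> \<open>The slope is chosen so that, after integration over \<open>{t..T}\<close>, the
    growth exceeds the linear term \<open>p \<bullet> c\<close> by \<open>norm p\<close>.\<close>
  define R where "R = (norm c + 1) / (T - t)"
  have R: "R * (T - t) = norm c + 1" using t by (simp add: R_def)
  obtain C where C: "C \<ge> 0" "\<And>p. R * norm p - C \<le> legendre l p"
    using legendre_bound[of R] by blast
  have "norm p - C * (T - t) \<le> H p" for p
  proof -
    have "integral {t..T} (\<lambda>s. R * norm p - C) \<le> integral {t..T} (\<lambda>s. d t s * legendre l ((1 / d t s) *\<^sub>R p))"
    proof (intro integral_le iL)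
      fix s assume s: "s \<in> {t..T}"
      then have b: "0 < d t s" "d t s \<le> 1" using d_bounds[OF tT] sub by blast+
      have "d t s * (R * norm ((1 / d t s) *\<^sub>R p) - C) \<le> d t s * legendre l ((1 / d t s) *\<^sub>R p)"
        using b by (intro mult_left_mono C(2)) simp
      moreover have "d t s * (R * norm ((1 / d t s) *\<^sub>R p) - C) = R * norm p - d t s * C"
        using b by (simp add: algebra_simps)
      moreover have "d t s * C \<le> C" using b C(1) by (simp add: mult_left_le_one_le)
      ultimately show "R * norm p - C \<le> d t s * legendre l ((1 / d t s) *\<^sub>R p)" by linarith
    qed (rule integrable_const_ivl)
    moreover have "integral {t..T} (\<lambda>s. R * norm p - C) = (R * (T - t)) * norm p - C * (T - t)"
      using t by (simp add: algebra_simps)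
    moreover have "p \<bullet> c \<le> norm c * norm p" using norm_cauchy_schwarz[of p c] by (simp add: mult.commute)
    ultimately show ?thesis unfolding H_def R by (simp add: algebra_simps)
  qed
  then obtain p where p: "\<And>q. H p \<le> H q" using attains_min[OF contH] by blast
  \<comment> \<open>The subgradient inequality at \<open>p + \<theta> *\<^sub>R e\<close>, compared
    with the minimum at \<open>p\<close>, gives a sign for positive \<open>\<theta>\<close>. Letting
    \<open>\<theta>\<close> tend to 0 carries it over to \<open>p\<close>, and arbitrary
    \<open>e\<close> forces \<open>F p = c\<close>.\<close>
  have "((\<lambda>\<theta>. (F (p + \<theta> *\<^sub>R e) - c) \<bullet> e) \<longlongrightarrow> (F p - c) \<bullet> e) (at_right 0)" for e
  proof -
    have "continuous_on UNIV (\<lambda>\<theta>::real. (F (p + \<theta> *\<^sub>R e) - c) \<bullet> e)"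
      by (intro continuous_intros continuous_on_compose2[OF contF]) auto
    then have "((\<lambda>\<theta>. (F (p + \<theta> *\<^sub>R e) - c) \<bullet> e) \<longlongrightarrow> (F (p + 0 *\<^sub>R e) - c) \<bullet> e) (at 0)"
      unfolding continuous_on_def by blast
    then show ?thesis by (simp add: filterlim_at_split)
  qed
  moreover have "\<forall>\<^sub>F \<theta> in at_right 0. (F (p + \<theta> *\<^sub>R e) - c) \<bullet> e \<ge> 0" for e
    unfolding eventually_at
  proof (intro exI[of _ 1] conjI ballI impI)
    fix \<theta> :: real assume "\<theta> \<in> {0<..}"
    then have \<theta>: "\<theta> > 0" by simp
    have "H (p + \<theta> *\<^sub>R e) - \<theta> * ((F (p + \<theta> *\<^sub>R e) - c) \<bullet> e) \<le> H p"
      using sub_grad[of "p + \<theta> *\<^sub>R e" p] by simp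
    then have "\<theta> * ((F (p + \<theta> *\<^sub>R e) - c) \<bullet> e) \<ge> 0" using p[of "p + \<theta> *\<^sub>R e"] by linarith
    then show "(F (p + \<theta> *\<^sub>R e) - c) \<bullet> e \<ge> 0" using \<theta> by (simp add: zero_le_mult_iff)
  qed simp
  ultimately have "(F p - c) \<bullet> e \<ge> 0" for e
    by (intro tendsto_lowerbound[of "\<lambda>\<theta>. (F (p + \<theta> *\<^sub>R e) - c) \<bullet> e" _ "at_right 0"]) auto
  from this[of "- (F p - c)"] have "(F p - c) \<bullet> (F p - c) \<le> 0"
    unfolding inner_minus_right by linarith
  then have "F p = c" by (metis eq_iff_diff_eq_0 inner_gt_zero_iff not_le)
  then have "integral {t..T} (ctrl d l t (\<iota> p)) = c"
    by (simp add: F_def ctrl_eq[abs_def])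
  then show thesis by (rule that)
qed

section \<open>Bounds on the cost and the value function\<close>

lemma cost_finite:
  assumes "0 \<le> t" "t < T" "y \<in> AC T x t" "cost T d l g t y \<noteq> \<infinity>"
  defines "h \<equiv> \<lambda>s. vector_derivative y (at s within {t..T})"
  shows "(h has_integral (y T - x)) {t..T}" "h absolutely_integrable_on {t..T}"
    "(\<lambda>s. d t s * l (h s)) integrable_on {t..T}"
    "cost T d l g t y = ereal (integral {t..T} (\<lambda>s. d t s * l (h s)) + d t T * g (y T))"
proof -
  have ac: "abs_continuous_on {t..T} y" "y t = x" using assms(3) by (auto simp: AC_def)
  show "(h has_integral (y T - x)) {t..T}" "h absolutely_integrable_on {t..T}"
    using abs_continuous_derivative[OF assms(2) ac(1)] ac(2) by (simp_all add: h_def)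
  have set: "set_integrable lebesgue {t..T} (\<lambda>s. d t s * l (h s))"
    using assms(4) unfolding cost_def Let_def h_def by (auto split: if_splits)
  then show "(\<lambda>s. d t s * l (h s)) integrable_on {t..T}"
    by (rule set_lebesgue_integral_eq_integral(1))
  show "cost T d l g t y = ereal (integral {t..T} (\<lambda>s. d t s * l (h s)) + d t T * g (y T))"
    using set set_lebesgue_integral_eq_integral(2)[OF set] by (simp add: cost_def Let_def h_def)
qed

text \<open>Choose the extremal with the end point of \<open>y\<close>. In the gradient inequality
  at its velocity the linear term has the constant coefficient \<open>grad l \<beta>\<close> and
  integrates to 0, since both velocities have integral \<open>y T - x\<close>.\<close>

lemma Vfun_le_cost:
  assumes t: "0 \<le> t" "t < T" and y: "y \<in> AC T x t"
  obtains \<beta> where "ereal (Vfun T d l g x t \<beta>) \<le> cost T d l g t y"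
proof (cases "cost T d l g t y = \<infinity>")
  case True
  then show thesis by (intro that) auto
next
  case False
  define h where "h s = vector_derivative y (at s within {t..T})" for s
  note h = cost_finite[OF t y False, folded h_def]
  have tT: "t \<in> {0..T}" and sub: "{t..T} \<subseteq> {0..T}" using t by auto
  obtain \<beta> where \<beta>: "integral {t..T} (ctrl d l t \<beta>) = y T - x" using ctrl_reaches[OF t] by blast
  let ?U = "ctrl d l t \<beta>"
  have U: "(?U has_integral (y T - x)) {t..T}"
    using \<beta> continuous_ctrl[OF tT sub] by (metis integrable_continuous_real integrable_integral)
  have iU: "(\<lambda>s. d t s * l (?U s)) integrable_on {t..T}"
    using continuous_cost[OF tT sub continuous_ctrl[OF tT sub]] by (rule integrable_continuous_real)
  have "((\<lambda>s. grad l \<beta> \<bullet> (h s - ?U s)) has_integral grad l \<beta> \<bullet> ((y T - x) - (y T - x))) {t..T}"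
    using has_integral_linear[OF has_integral_diff[OF h(1) U] bounded_linear_inner_right] by (simp add: o_def)
  then have zero: "((\<lambda>s. grad l \<beta> \<bullet> (h s - ?U s)) has_integral 0) {t..T}" by simp
  have "integral {t..T} (\<lambda>s. d t s * l (?U s) + grad l \<beta> \<bullet> (h s - ?U s))
      \<le> integral {t..T} (\<lambda>s. d t s * l (h s))"
  proof (intro integral_le integrable_add iU h(3) has_integral_integrable[OF zero])
    fix s assume s: "s \<in> {t..T}"
    have "d t s * (l (?U s) + grad l (?U s) \<bullet> (h s - ?U s)) \<le> d t s * l (h s)"
      using d_bounds[OF tT, of s] s sub gradient_le by (intro mult_left_mono) auto
    moreover have "d t s * (grad l (?U s) \<bullet> (h s - ?U s)) = grad l \<beta> \<bullet> (h s - ?U s)"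
      using grad_ctrl[OF tT, of s \<beta>] s sub by (metis inner_scaleR_left subsetD)
    ultimately show "d t s * l (?U s) + grad l \<beta> \<bullet> (h s - ?U s) \<le> d t s * l (h s)"
      by (simp only: distrib_left)
  qed
  then have "Vfun T d l g x t \<beta> \<le> integral {t..T} (\<lambda>s. d t s * l (h s)) + d t T * g (y T)"
    using integral_add[OF iU has_integral_integrable[OF zero]] integral_unique[OF zero] \<beta>
    by (simp add: Vfun_eq[OF tT])
  then show thesis using h(4) by (intro that) simp
qed

text \<open>Needed because \<open>val\<close> uses \<open>real_of_ereal\<close>, which sends
  \<open>-\<infinity>\<close> to 0: without a finite lower bound, \<open>val\<close> would not be
  below the cost of a competitor.\<close>

lemma cost_lower_bound:
  assumes t: "0 \<le> t" "t < T"
  obtains M where "\<And>y. y \<in> AC T x t \<Longrightarrow> ereal M \<le> cost T d l g t y"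
proof -
  have tT: "t \<in> {0..T}" "T \<in> {0..T}" and sub: "{t..T} \<subseteq> {0..T}" using t by auto
  obtain L where L: "L-lipschitz_on UNIV g" using g_lipschitz by blast
  have L0: "L \<ge> 0" using L by (rule lipschitz_on_nonneg)
  \<comment> \<open>As \<open>d\<close> stays above \<open>a\<close>, slope \<open>L / a\<close>
    leaves running cost at least \<open>L\<close> times the speed, up to a constant. This pays for
    any decrease of the Lipschitz terminal cost.\<close>
  obtain C where C: "C \<ge> 0" "\<And>u. (L / a) * norm u - C \<le> l u" using superlinear_bound[of "L / a"] by blast
  have "ereal (d t T * g x - C * (T - t)) \<le> cost T d l g t y" if y: "y \<in> AC T x t" for y
  proof (cases "cost T d l g t y = \<infinity>")
    case False
    define h where "h s = vector_derivative y (at s within {t..T})" for s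
    note h = cost_finite[OF t y False, folded h_def]
    have ih: "(\<lambda>s. norm (h s)) integrable_on {t..T}"
      using h(2) by (simp add: absolutely_integrable_on_def)
    have "norm (y T - x) \<le> integral {t..T} (\<lambda>s. norm (h s))"
      using integral_norm_bound_integral[OF has_integral_integrable[OF h(1)] ih] integral_unique[OF h(1)] by simp
    then have "L * norm (y T - x) \<le> L * integral {t..T} (\<lambda>s. norm (h s))" using L0 by (rule mult_left_mono)
    moreover have "integral {t..T} (\<lambda>s. L * norm (h s) - C) \<le> integral {t..T} (\<lambda>s. d t s * l (h s))"
    proof (intro integral_le h(3) integrable_diff integrable_on_mult_right ih integrable_const_ivl)
      fix s assume s: "s \<in> {t..T}"
      then have b: "a < d t s" "0 < d t s" "d t s \<le> 1" using d_bounds[OF tT(1)] sub by blast+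
      have "d t s * ((L / a) * norm (h s) - C) \<le> d t s * l (h s)"
        using C(2) b by (intro mult_left_mono) auto
      moreover have "a * ((L / a) * norm (h s)) \<le> d t s * ((L / a) * norm (h s))"
        using b L0 a_pos by (intro mult_right_mono) auto
      moreover have "a * ((L / a) * norm (h s)) = L * norm (h s)" using a_pos by simp
      moreover have "d t s * C \<le> C" using b C(1) by (simp add: mult_left_le_one_le)
      ultimately show "L * norm (h s) - C \<le> d t s * l (h s)" unfolding right_diff_distrib by linarith
    qed
    moreover have "integral {t..T} (\<lambda>s. L * norm (h s) - C) = L * integral {t..T} (\<lambda>s. norm (h s)) - C * (T - t)"
      using integral_diff[OF integrable_on_mult_right[OF ih] integrable_const_ivl, of L C] t by simp
    moreover have "d t T * g x - L * norm (y T - x) \<le> d t T * g (y T)"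
    proof -
      have "\<bar>g (y T) - g x\<bar> \<le> L * norm (y T - x)"
        using lipschitz_onD[OF L, of "y T" x] by (simp add: dist_norm)
      then have "g x - g (y T) \<le> L * norm (y T - x)" by linarith
      then have "d t T * (g x - g (y T)) \<le> d t T * (L * norm (y T - x))"
        using d_bounds[OF tT] by (intro mult_left_mono) auto
      also have "\<dots> \<le> L * norm (y T - x)"
        using d_bounds[OF tT] L0 by (intro mult_left_le_one_le) auto
      finally show ?thesis unfolding right_diff_distrib by linarith
    qed
    ultimately show ?thesis unfolding h(4) by simp
  qed simp
  then show thesis by (rule that)
qed

lemma cost_indefinite_integral:
  assumes t: "0 \<le> t" "t < T" and u: "continuous_on {t..T} u"
  shows "(\<lambda>s. x + integral {t..s} u) \<in> AC T x t"
    "cost T d l g t (\<lambda>s. x + integral {t..s} u) =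
      ereal (integral {t..T} (\<lambda>s. d t s * l (u s)) + d t T * g (x + integral {t..T} u))"
proof -
  let ?y = "\<lambda>s. x + integral {t..s} u"
  have tT: "t \<in> {0..T}" and sub: "{t..T} \<subseteq> {0..T}" using t by auto
  show "?y \<in> AC T x t" using abs_continuous_on_indefinite_integral[OF u] by (simp add: AC_def)
  \<comment> \<open>Taken within \<open>{t..T}\<close>, the derivative equals \<open>u\<close> at
    both end points too, so the cost integrand is continuous.\<close>
  have vd: "vector_derivative ?y (at s within {t..T}) = u s" if "s \<in> {t..T}" for s
  proof (rule vector_derivative_within_closed_interval[OF t(2)])
    show "(?y has_vector_derivative u s) (at s within {t..T})"
      using has_vector_derivative_add[OF has_vector_derivative_const integral_has_vector_derivative[OF u that], of x]
      by simp
  qed (use that in auto)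
  have cont: "continuous_on {t..T} (\<lambda>s. d t s * l (vector_derivative ?y (at s within {t..T})))"
    using continuous_cost[OF tT sub u] by (rule continuous_on_eq) (simp add: vd)
  have "integral {t..T} (\<lambda>s. d t s * l (vector_derivative ?y (at s within {t..T})))
      = integral {t..T} (\<lambda>s. d t s * l (u s))"
    by (intro Henstock_Kurzweil_Integration.integral_cong) (simp add: vd)
  then show "cost T d l g t ?y =
      ereal (integral {t..T} (\<lambda>s. d t s * l (u s)) + d t T * g (x + integral {t..T} u))"
    using absolutely_integrable_continuous_real[OF cont] continuous_LINT[OF cont]
    by (simp add: cost_def Let_def)
qed

lemma val_le:
  assumes t: "0 \<le> t" "t < T" and u: "continuous_on {t..T} u"
  shows "val T d l g x t \<le> integral {t..T} (\<lambda>s. d t s * l (u s)) + d t T * g (x + integral {t..T} u)"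
proof -
  obtain M where "\<And>y. y \<in> AC T x t \<Longrightarrow> ereal M \<le> cost T d l g t y" using cost_lower_bound[OF t] by blast
  then have lower: "ereal M \<le> (INF y\<in>AC T x t. cost T d l g t y)" by (intro INF_greatest)
  have "(INF y\<in>AC T x t. cost T d l g t y)
      \<le> ereal (integral {t..T} (\<lambda>s. d t s * l (u s)) + d t T * g (x + integral {t..T} u))"
    using cost_indefinite_integral[OF t u] by (metis INF_lower)
  with lower show ?thesis unfolding val_def
    by (cases "INF y\<in>AC T x t. cost T d l g t y") auto
qed

lemma val_eq:
  assumes t: "0 \<le> t" "t < T" and \<alpha>: "\<alpha> \<in> Amin T d l g x t"
  shows "val T d l g x t = Vfun T d l g x t \<alpha>"
proof (rule antisym)
  have tT: "t \<in> {0..T}" and sub: "{t..T} \<subseteq> {0..T}" using t by auto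
  show "val T d l g x t \<le> Vfun T d l g x t \<alpha>"
    unfolding Vfun_eq[OF tT] by (rule val_le[OF t continuous_ctrl[OF tT sub]])
  have min: "Vfun T d l g x t \<alpha> \<le> Vfun T d l g x t \<beta>" for \<beta>
    using \<alpha> by (simp add: Amin_def is_arg_min_linorder)
  have lower: "ereal (Vfun T d l g x t \<alpha>) \<le> (INF y\<in>AC T x t. cost T d l g t y)"
  proof (rule INF_greatest)
    fix y assume "y \<in> AC T x t"
    then obtain \<beta> where "ereal (Vfun T d l g x t \<beta>) \<le> cost T d l g t y" using Vfun_le_cost[OF t] by blast
    then show "ereal (Vfun T d l g x t \<alpha>) \<le> cost T d l g t y"
      using min[of \<beta>] by (meson ereal_less_eq(3) order_trans)
  qed
  have "(INF y\<in>AC T x t. cost T d l g t y) \<le> ereal (Vfun T d l g x t \<alpha>)"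
    using cost_indefinite_integral[OF t continuous_ctrl[OF tT sub], of x \<alpha>]
    unfolding Vfun_eq[OF tT] by (metis INF_lower)
  with lower show "Vfun T d l g x t \<alpha> \<le> val T d l g x t" unfolding val_def
    by (cases "INF y\<in>AC T x t. cost T d l g t y") auto
qed

end

section \<open>The Hamilton-Jacobi equation\<close>

text \<open>The contact is two-sided: \<open>h - f\<close> has a local minimum at \<open>z\<close>,
  so its derivative vanishes there.\<close>

lemma derivative_eq_of_touching:
  fixes f h :: "real \<Rightarrow> real"
  assumes f: "(f has_real_derivative A) (at z)" and h: "(h has_real_derivative B) (at z)"
    and eq: "f z = h z" and le: "\<forall>\<^sub>F w in at z. f w \<le> h w"
  shows "A = B"
proof -
  have "((\<lambda>w. h w - f w) has_derivative (\<lambda>w. (B - A) * w)) (at z)"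
    using DERIV_diff[OF h f] by (simp add: has_field_derivative_def)
  then have "(\<lambda>w. (B - A) * w) = (\<lambda>w. 0)"
    by (rule has_derivative_local_min) (use le eq in \<open>simp add: eventually_mono\<close>)
  then show ?thesis by (metis diff_eq_diff_eq diff_self mult.right_neutral)
qed

lemma tail_integral_derivative:
  fixes k :: "real \<Rightarrow> 'b::euclidean_space"
  assumes k: "continuous_on {0..T} k" and t: "0 < t" "t < T"
  shows "((\<lambda>\<tau>. integral {\<tau>..T} k) has_vector_derivative - k t) (at t)"
proof -
  have tT: "t \<in> {0..T}" using t by simp
  have "at t within {0..T} = at t" using t by (intro at_within_interior) simp
  then have "((\<lambda>\<tau>. integral {0..\<tau>} k) has_vector_derivative k t) (at t)"
    using integral_has_vector_derivative[OF k tT] by simp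
  from has_vector_derivative_diff[OF has_vector_derivative_const this, of "integral {0..T} k"]
  have "((\<lambda>\<tau>. integral {0..T} k - integral {0..\<tau>} k) has_vector_derivative - k t) (at t)" by simp
  then show ?thesis
  proof (rule has_vector_derivative_transform_within_open)
    fix \<tau> assume "\<tau> \<in> {0<..<T}"
    then have "integral {0..\<tau>} k + integral {\<tau>..T} k = integral {0..T} k"
      using integrable_continuous_real[OF k] by (intro Henstock_Kurzweil_Integration.integral_combine) auto
    then show "integral {0..T} k - integral {0..\<tau>} k = integral {\<tau>..T} k" by (simp add: algebra_simps)
  qed (use t in auto)
qed

context discounted_problem
begin

text \<open>The control perturbed by \<open>\<epsilon> w\<close> leads from \<open>x + \<epsilon> e\<close> to the same end point, so that \<open>\<psi>\<close> touches the value
  function from above.\<close>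

lemma val_space_derivative:
  assumes t: "0 \<le> t" "t < T" and \<alpha>: "\<alpha> \<in> Amin T d l g x t"
    and v': "((\<lambda>(\<xi>, \<tau>). val T d l g \<xi> \<tau>) has_derivative v') (at (x, t))"
  shows "v' (e, 0) = - (grad l \<alpha> \<bullet> e)"
proof -
  have tT: "t \<in> {0..T}" and sub: "{t..T} \<subseteq> {0..T}" using t by auto
  interpret v': bounded_linear v' using v' by (rule has_derivative_bounded_linear)
  \<comment> \<open>The constant control with integral \<open>- e\<close> over
    \<open>{t..T}\<close>, which undoes the displacement \<open>e\<close> of the initial
    point.\<close>
  define w where "w = (- (1 / (T - t))) *\<^sub>R e"
  define u where "u = ctrl d l t \<alpha>"
  have u: "continuous_on {t..T} u" unfolding u_def by (rule continuous_ctrl[OF tT sub])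
  define \<psi> where "\<psi> \<epsilon> = integral {t..T} (\<lambda>s. d t s * l (u s + \<epsilon> *\<^sub>R w))
    + d t T * g (x + integral {t..T} u)" for \<epsilon>
  have le: "val T d l g (x + \<epsilon> *\<^sub>R e) t \<le> \<psi> \<epsilon>" for \<epsilon>
  proof -
    have "integral {t..T} (\<lambda>s. u s + \<epsilon> *\<^sub>R w) = integral {t..T} u + (T - t) *\<^sub>R \<epsilon> *\<^sub>R w"
      using integral_add[OF integrable_continuous_real[OF u] integrable_const_ivl, of "\<epsilon> *\<^sub>R w"] t by simp
    also have "(T - t) *\<^sub>R \<epsilon> *\<^sub>R w = - \<epsilon> *\<^sub>R e" using t by (simp add: w_def)
    finally have endpoint: "x + \<epsilon> *\<^sub>R e + integral {t..T} (\<lambda>s. u s + \<epsilon> *\<^sub>R w) = x + integral {t..T} u" by simp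
    show ?thesis
      using val_le[OF t continuous_on_add[OF u continuous_on_const], of "x + \<epsilon> *\<^sub>R e" "\<epsilon> *\<^sub>R w"]
      unfolding endpoint \<psi>_def .
  qed
  have eq: "val T d l g x t = \<psi> 0"
    using val_eq[OF t \<alpha>] by (simp add: \<psi>_def u_def Vfun_eq[OF tT])
  have line: "continuous_on (UNIV \<times> cbox t T) (\<lambda>(\<epsilon>::real, s). u s + \<epsilon> *\<^sub>R w)"
    unfolding split_def
    by (intro continuous_intros continuous_on_compose2[OF u continuous_on_snd[OF continuous_on_id]]) auto
  have snd_d: "continuous_on (UNIV \<times> cbox t T) (\<lambda>p::real \<times> real. d t (snd p))"
    by (rule continuous_on_compose2[OF continuous_d[OF tT sub] continuous_on_snd[OF continuous_on_id]]) auto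
  have "((\<lambda>\<epsilon>. integral (cbox t T) (\<lambda>s. d t s * l (u s + \<epsilon> *\<^sub>R w))) has_real_derivative
      integral (cbox t T) (\<lambda>s. d t s * (grad l (u s + 0 *\<^sub>R w) \<bullet> w))) (at 0 within UNIV)"
  proof (rule leibniz_rule_field_derivative)
    fix \<epsilon> s :: real
    show "((\<lambda>\<epsilon>. d t s * l (u s + \<epsilon> *\<^sub>R w)) has_real_derivative d t s * (grad l (u s + \<epsilon> *\<^sub>R w) \<bullet> w))
        (at \<epsilon> within UNIV)"
      by (rule DERIV_cmult[OF l_along_line])
    have "continuous_on {t..T} (\<lambda>s. d t s * l (u s + \<epsilon> *\<^sub>R w))"
      by (rule continuous_cost[OF tT sub]) (intro continuous_intros u)
    then show "(\<lambda>s. d t s * l (u s + \<epsilon> *\<^sub>R w)) integrable_on cbox t T"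
      using integrable_continuous_real by simp
    show "continuous_on (UNIV \<times> cbox t T) (\<lambda>(\<epsilon>, s). d t s * (grad l (u s + \<epsilon> *\<^sub>R w) \<bullet> w))"
      using continuous_on_compose2[OF continuous_grad[of UNIV] line]
      unfolding split_def by (intro continuous_intros snd_d) auto
  qed auto
  then have "(\<psi> has_real_derivative integral {t..T} (\<lambda>s. d t s * (grad l (u s) \<bullet> w))) (at 0)"
    unfolding \<psi>_def[abs_def] using DERIV_add[OF _ DERIV_const] by fastforce
  \<comment> \<open>By \<open>grad_ctrl\<close> the first variation has a constant integrand, so it
    sees only the total displacement.\<close>
  moreover have "integral {t..T} (\<lambda>s. d t s * (grad l (u s) \<bullet> w)) = integral {t..T} (\<lambda>s. grad l \<alpha> \<bullet> w)"
  proof (rule Henstock_Kurzweil_Integration.integral_cong)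
    fix s assume "s \<in> {t..T}"
    then show "d t s * (grad l (u s) \<bullet> w) = grad l \<alpha> \<bullet> w"
      using grad_ctrl[OF tT, of s \<alpha>] sub by (metis inner_scaleR_left subsetD u_def)
  qed
  moreover have "integral {t..T} (\<lambda>s. grad l \<alpha> \<bullet> w) = - (grad l \<alpha> \<bullet> e)"
    using t by (simp add: w_def)
  ultimately have \<psi>': "(\<psi> has_real_derivative - (grad l \<alpha> \<bullet> e)) (at 0)" by simp
  have "((\<lambda>\<epsilon>. (x + \<epsilon> *\<^sub>R e, t)) has_derivative (\<lambda>\<epsilon>. (\<epsilon> *\<^sub>R e, 0))) (at 0)"
    by (auto intro!: derivative_eq_intros)
  from has_derivative_compose[OF this, of "\<lambda>(\<xi>, \<tau>). val T d l g \<xi> \<tau>" v'] v'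
  have "((\<lambda>\<epsilon>. val T d l g (x + \<epsilon> *\<^sub>R e) t) has_derivative (\<lambda>\<epsilon>. v' (\<epsilon> *\<^sub>R e, 0))) (at 0)" by simp
  moreover have "v' (\<epsilon> *\<^sub>R e, 0) = v' (e, 0) * \<epsilon>" for \<epsilon> using v'.scaleR[of \<epsilon> "(e, 0)"] by simp
  ultimately have "((\<lambda>\<epsilon>. val T d l g (x + \<epsilon> *\<^sub>R e) t) has_real_derivative v' (e, 0)) (at 0)"
    by (simp add: has_field_derivative_def)
  from derivative_eq_of_touching[OF this \<psi>'] le eq show ?thesis by simp
qed

text \<open>Only a pointwise derivative of \<open>d\<close> in \<open>t\<close> is at hand, so
  dominated convergence replaces the Leibniz rule, with the Lipschitz constant of \<open>d\<close>
  dominating the quotients. The increment splits into the change of the discount over the moving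
  range and the change of the range under the discount fixed at \<open>t\<close>.\<close>

lemma discounted_integral_derivative:
  assumes t: "0 < t" "t < T" and m: "continuous_on {0..T} m"
    and diff: "\<And>s. t \<le> s \<Longrightarrow> s \<le> T \<Longrightarrow> (\<lambda>\<tau>. d \<tau> s) differentiable (at t within {0..s})"
  shows "((\<lambda>\<tau>. integral {\<tau>..T} (\<lambda>s. d \<tau> s * m s)) has_real_derivative
      integral {t..T} (\<lambda>s. dt d t s * m s) - m t) (at t)"
    and "(\<lambda>s. dt d t s * m s) absolutely_integrable_on {t..T}"
proof -
  have tT: "t \<in> {0..T}" using t by simp
  obtain L where L: "L-lipschitz_on ({0..T} \<times> {0..T}) (\<lambda>(t, s). d t s)" using d_lipschitz by blast
  have lip: "\<bar>d \<tau> s - d t s\<bar> \<le> L * \<bar>\<tau> - t\<bar>" if "\<tau> \<in> {0..T}" "s \<in> {0..T}" for \<tau> s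
    using lipschitz_onD[OF L, of "(\<tau>, s)" "(t, s)"] that tT by (simp add: dist_Pair_Pair dist_real_def)
  have L0: "L \<ge> 0" using L by (rule lipschitz_on_nonneg)
  have "bounded (m ` {0..T})" using m by (intro compact_imp_bounded compact_continuous_image) auto
  then obtain B where B: "B > 0" "\<And>s. s \<in> {0..T} \<Longrightarrow> \<bar>m s\<bar> \<le> B" unfolding bounded_pos by auto
  have dt: "((\<lambda>\<tau>. d \<tau> s) has_real_derivative dt d t s) (at t)" if s: "t < s" "s \<le> T" for s
  proof -
    have at: "at t within {0..s} = at t" using s t by (intro at_within_interior) simp
    have "((\<lambda>\<tau>. d \<tau> s) has_vector_derivative dt d t s) (at t within {0..s})"
      unfolding dt_def vector_derivative_works[symmetric] using diff s by simp
    then show ?thesis by (simp add: at has_real_derivative_iff_has_vector_derivative)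
  qed
  have quot: "((\<lambda>\<tau>. (d \<tau> s - d t s) / (\<tau> - t)) \<longlongrightarrow> dt d t s) (at t)" if "t < s" "s \<le> T" for s
    using dt[OF that] by (simp add: has_field_derivative_iff)
  \<comment> \<open>The quotients are extended by 0 to the fixed interval \<open>{0..T}\<close>. At
    \<open>s = t\<close>, a null set, they are set to 0: the derivative there is only one-sided, and
    the cutoff \<open>s < \<tau>\<close> acts only for \<open>\<tau> > t\<close>.\<close>
  define q where "q \<tau> s = (if s = t \<or> s < \<tau> then 0 else (d \<tau> s - d t s) / (\<tau> - t) * m s)" for \<tau> s
  define r where "r s = (if s \<le> t then 0 else dt d t s * m s)" for s
  define D where "D \<tau> = integral {\<tau>..T} (\<lambda>s. d \<tau> s * m s) - integral {\<tau>..T} (\<lambda>s. d t s * m s)" for \<tau>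
  have ci: "(\<lambda>s. d \<sigma> s * m s) integrable_on {\<tau>..T}" if "\<tau> \<in> {0..T}" "\<sigma> \<in> {0..T}" for \<tau> \<sigma>
    using that by (intro integrable_continuous_real continuous_intros continuous_d
        continuous_on_subset[OF m]) auto
  have q: "(q \<tau> has_integral D \<tau> / (\<tau> - t)) {0..T}" if \<tau>: "\<tau> \<in> {0<..<T}" for \<tau>
  proof -
    have "((\<lambda>s. (d \<tau> s * m s - d t s * m s) / (\<tau> - t)) has_integral D \<tau> / (\<tau> - t)) {\<tau>..T}"
      unfolding D_def using \<tau> tT
      by (intro has_integral_divide has_integral_diff integrable_integral ci) auto
    then have "((\<lambda>s. if s \<in> {\<tau>..T} then (d \<tau> s * m s - d t s * m s) / (\<tau> - t) else 0)
        has_integral D \<tau> / (\<tau> - t)) {0..T}"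
      using \<tau> by (subst has_integral_restrict) auto
    then show ?thesis
      by (rule has_integral_spike[OF negligible_sing[of t], rotated])
        (auto simp: q_def left_diff_distrib)
  qed
  have conv: "r integrable_on {0..T} \<and> (\<lambda>n. D (X n) / (X n - t)) \<longlonglongrightarrow> integral {0..T} r"
    if X: "\<And>n. X n \<in> {0<..<T} - {t}" "X \<longlonglongrightarrow> t" for X
  proof -
    have Xat: "filterlim X (at t) sequentially"
      using X by (auto simp: filterlim_at)
    have int: "q (X n) integrable_on {0..T}" for n using q[of "X n"] X(1) by blast
    have bd: "norm (q (X n) s) \<le> L * B" if s: "s \<in> {0..T}" for n s
    proof -
      have Xn: "X n \<in> {0..T}" "X n \<noteq> t" using X(1)[of n] by auto
      have "\<bar>(d (X n) s - d t s) / (X n - t)\<bar> \<le> L"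
        using lip[OF Xn(1) s] Xn(2) by (simp add: abs_divide pos_divide_le_eq)
      then have "\<bar>(d (X n) s - d t s) / (X n - t)\<bar> * \<bar>m s\<bar> \<le> L * B"
        using B(2)[OF s] L0 by (intro mult_mono) auto
      then show ?thesis using L0 B(1) by (auto simp: q_def abs_mult)
    qed
    have lim: "(\<lambda>n. q (X n) s) \<longlonglongrightarrow> r s" if s: "s \<in> {0..T}" for s
    proof -
      consider "s = t" | "s < t" | "t < s" by linarith
      then show ?thesis
      proof cases
        case 1
        then show ?thesis by (simp add: q_def r_def)
      next
        case 2
        then have "\<forall>\<^sub>F n in sequentially. s < X n" using X(2) by (auto dest: order_tendstoD)
        then have "\<forall>\<^sub>F n in sequentially. r s = q (X n) s"
          by eventually_elim (use 2 in \<open>simp add: q_def r_def\<close>)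
        then show ?thesis by (rule Lim_transform_eventually[OF tendsto_const])
      next
        case 3
        then have "\<forall>\<^sub>F n in sequentially. X n < s" using X(2) by (auto dest: order_tendstoD)
        then have ev: "\<forall>\<^sub>F n in sequentially. (d (X n) s - d t s) / (X n - t) * m s = q (X n) s"
          by eventually_elim (use 3 in \<open>simp add: q_def\<close>)
        have "(\<lambda>n. (d (X n) s - d t s) / (X n - t) * m s) \<longlonglongrightarrow> dt d t s * m s"
          using filterlim_compose[OF quot Xat] 3 s by (intro tendsto_intros) auto
        then have "(\<lambda>n. q (X n) s) \<longlonglongrightarrow> dt d t s * m s"
          using ev by (rule Lim_transform_eventually)
        then show ?thesis using 3 by (simp add: r_def)
      qed
    qed
    have "integral {0..T} (q (X n)) = D (X n) / (X n - t)" for n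
      using q[of "X n"] X(1) by (intro integral_unique) auto
    then show ?thesis
      using dominated_convergence[OF int integrable_const_ivl bd lim] by simp
  qed
  have r_int: "r integrable_on {0..T}"
  proof -
    \<comment> \<open>One admissible sequence suffices to obtain integrability of the limit; the
      factor 1/2 keeps even \<open>X 0\<close> below \<open>T\<close>.\<close>
    define X where "X n = t + (T - t) / 2 * inverse (real (Suc n))" for n
    have "X \<longlonglongrightarrow> t + (T - t) / 2 * 0" unfolding X_def
      by (intro tendsto_intros LIMSEQ_inverse_real_of_nat)
    moreover have "X n \<in> {0<..<T} - {t}" for n
    proof -
      define e where "e = (T - t) / 2 * inverse (real (Suc n))"
      have "e \<le> (T - t) / 2 * 1"
        unfolding e_def using t by (intro mult_left_mono) (auto simp: inverse_le_1_iff)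
      moreover have "e > 0" unfolding e_def using t by (intro mult_pos_pos) auto
      moreover have "X n = t + e" by (simp add: X_def e_def)
      ultimately have "0 < X n" "X n < T" "X n \<noteq> t" using t by auto
      then show ?thesis by simp
    qed
    ultimately show ?thesis using conv[of X] by simp
  qed
  have r_eq: "(r has_integral I) {0..T} \<longleftrightarrow> ((\<lambda>s. dt d t s * m s) has_integral I) {t..T}" for I
  proof -
    have "(r has_integral I) {0..T} \<longleftrightarrow>
      ((\<lambda>s. if s \<in> {t..T} then dt d t s * m s else 0) has_integral I) {0..T}"
      by (rule has_integral_spike_eq[OF negligible_sing[of t]]) (auto simp: r_def)
    also have "\<dots> \<longleftrightarrow> ((\<lambda>s. dt d t s * m s) has_integral I) {t..T}"
      using t by (intro has_integral_restrict) auto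
    finally show ?thesis .
  qed
  have int: "(\<lambda>s. dt d t s * m s) integrable_on {t..T}"
    and integral_r: "integral {0..T} r = integral {t..T} (\<lambda>s. dt d t s * m s)"
    using r_int r_eq by (auto simp: integrable_on_def intro!: integral_unique[symmetric])
  have "r absolutely_integrable_on {0..T}"
  proof (rule absolutely_integrable_integrable_bound[OF _ r_int integrable_const_ivl])
    fix s assume s: "s \<in> {0..T}"
    show "norm (r s) \<le> L * B"
    proof (cases "s \<le> t")
      case True
      then show ?thesis using L0 B(1) by (simp add: r_def)
    next
      case False
      then have s': "t < s" "s \<le> T" using s by auto
      \<comment> \<open>The Lipschitz bound on the quotients passes to \<open>dt\<close>. It makes
        the integral absolute, as required to identify it with the Lebesgue integral in
        \<open>wfun\<close>.\<close>
      have "\<forall>\<^sub>F \<tau> in at t. \<bar>(d \<tau> s - d t s) / (\<tau> - t)\<bar> \<le> L"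
        unfolding eventually_at
      proof (intro exI[of _ "min t (T - t)"] conjI ballI impI)
        fix \<tau> assume "\<tau> \<noteq> t \<and> dist \<tau> t < min t (T - t)"
        then have "\<tau> \<noteq> t" "\<tau> \<in> {0..T}" by (auto simp: dist_real_def abs_less_iff)
        then show "\<bar>(d \<tau> s - d t s) / (\<tau> - t)\<bar> \<le> L"
          using lip[of \<tau> s] s by (simp add: abs_divide pos_divide_le_eq)
      qed (use t in auto)
      then have "\<bar>dt d t s\<bar> \<le> L"
        by (rule tendsto_upperbound[OF tendsto_rabs[OF quot[OF s']]]) simp
      then have "\<bar>dt d t s\<bar> * \<bar>m s\<bar> \<le> L * B" using B(2)[OF s] L0 by (intro mult_mono) auto
      then show ?thesis using False by (simp add: r_def abs_mult)
    qed
  qed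
  then have "r absolutely_integrable_on {t..T}"
    by (rule set_integrable_subset) (use t in auto)
  then show "(\<lambda>s. dt d t s * m s) absolutely_integrable_on {t..T}"
    by (rule absolutely_integrable_spike[OF _ negligible_sing[of t]]) (auto simp: r_def)
  have "((\<lambda>\<tau>. D \<tau> / (\<tau> - t)) \<longlongrightarrow> integral {0..T} r) (at t within {0<..<T})"
    unfolding tendsto_at_iff_sequentially using conv by (auto simp: o_def)
  moreover have "at t within {0<..<T} = at t" using t by (intro at_within_open) auto
  ultimately have lim1: "((\<lambda>\<tau>. D \<tau> / (\<tau> - t)) \<longlongrightarrow> integral {0..T} r) (at t)" by simp
  let ?K = "\<lambda>\<tau>. integral {\<tau>..T} (\<lambda>s. d t s * m s)"
  have "continuous_on {0..T} (\<lambda>s. d t s * m s)" by (intro continuous_intros continuous_d tT m order_refl)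
  from tail_integral_derivative[OF this t] have "(?K has_real_derivative - m t) (at t)"
    by (simp add: has_real_derivative_iff_has_vector_derivative d_diag[OF tT])
  then have "((\<lambda>\<tau>. (?K \<tau> - ?K t) / (\<tau> - t)) \<longlongrightarrow> - m t) (at t)"
    by (simp add: has_field_derivative_iff)
  from tendsto_add[OF lim1 this]
  show "((\<lambda>\<tau>. integral {\<tau>..T} (\<lambda>s. d \<tau> s * m s)) has_real_derivative
      integral {t..T} (\<lambda>s. dt d t s * m s) - m t) (at t)"
    unfolding has_field_derivative_iff integral_r by (simp add: D_def flip: add_divide_distrib)
qed

theorem hamilton_jacobi:
  assumes t: "0 < t" "t < T" and \<alpha>: "\<alpha> \<in> Amin T d l g x t"
    and diff: "\<And>s. t \<le> s \<Longrightarrow> s \<le> T \<Longrightarrow> (\<lambda>\<tau>. d \<tau> s) differentiable (at t within {0..s})"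
    and val: "(\<lambda>(\<xi>, \<tau>). val T d l g \<xi> \<tau>) differentiable (at (x, t))"
  shows "- deriv (\<lambda>\<tau>. val T d l g x \<tau>) t + legendre l (- grad (\<lambda>\<xi>. val T d l g \<xi> t) x)
    + wfun T d l g x t \<alpha> = 0"
proof -
  have tT: "t \<in> {0..T}" and sub: "{t..T} \<subseteq> {0..T}" and t0: "0 \<le> t" using t by auto
  obtain v' where v': "((\<lambda>(\<xi>, \<tau>). val T d l g \<xi> \<tau>) has_derivative v') (at (x, t))"
    using val unfolding differentiable_def by blast
  interpret v': bounded_linear v' using v' by (rule has_derivative_bounded_linear)
  note space = val_space_derivative[OF t0 t(2) \<alpha> v']
  have "((\<lambda>\<xi>. (\<xi>, t)) has_derivative (\<lambda>h. (h, 0))) (at x)" by (auto intro!: derivative_eq_intros)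
  from has_derivative_compose[OF this, of "\<lambda>(\<xi>, \<tau>). val T d l g \<xi> \<tau>" v'] v'
  have "((\<lambda>\<xi>. val T d l g \<xi> t) has_derivative (\<lambda>h. v' (h, 0))) (at x)" by simp
  then have "GDERIV (\<lambda>\<xi>. val T d l g \<xi> t) x :> - grad l \<alpha>"
    by (simp add: gderiv_def space inner_commute)
  then have grad: "grad (\<lambda>\<xi>. val T d l g \<xi> t) x = - grad l \<alpha>" by (rule grad_eqI)
  have "((\<lambda>\<tau>. (x, \<tau>)) has_derivative (\<lambda>h. (0, h))) (at t)" by (auto intro!: derivative_eq_intros)
  from has_derivative_compose[OF this, of "\<lambda>(\<xi>, \<tau>). val T d l g \<xi> \<tau>" v'] v'
  have "((\<lambda>\<tau>. val T d l g x \<tau>) has_derivative (\<lambda>h. v' (0, h))) (at t)" by simp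
  moreover have "(\<lambda>h. v' (0, h)) = (*) (v' (0, 1))"
  proof
    show "v' (0, h) = v' (0, 1) * h" for h using v'.scaleR[of h "(0, 1)"] by simp
  qed
  ultimately have "((\<lambda>\<tau>. val T d l g x \<tau>) has_real_derivative v' (0, 1)) (at t)"
    by (simp only: has_field_derivative_def)
  then have time: "deriv (\<lambda>\<tau>. val T d l g x \<tau>) t = v' (0, 1)" by (rule DERIV_imp_deriv)

  txt \<open>The optimal control is extended by \<open>\<alpha>\<close> to times before \<open>t\<close>, so that \<open>val (y \<tau>) \<tau> \<le> \<phi> \<tau>\<close> on both
    sides of \<open>\<tau> = t\<close>.\<close>
  define u where "u s = ctrl d l t \<alpha> (max t s)" for s
  have u: "continuous_on {0..T} u" unfolding u_def[abs_def]
    using t by (intro continuous_on_compose2[OF continuous_ctrl[OF tT sub]] continuous_intros) auto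
  have u_t: "u t = \<alpha>" by (simp add: u_def ctrl_eq d_diag[OF tT])
  have u_eq: "u s = ctrl d l t \<alpha> s" if "s \<in> {t..T}" for s using that by (simp add: u_def max_def)
  define z where "z = x + integral {t..T} u"
  \<comment> \<open>From every starting point \<open>y \<tau>\<close> the control \<open>u\<close>
    leads to the same \<open>z\<close> at time \<open>T\<close>.\<close>
  define y where "y \<tau> = z - integral {\<tau>..T} u" for \<tau>
  define \<phi> where "\<phi> \<tau> = integral {\<tau>..T} (\<lambda>s. d \<tau> s * l (u s)) + d \<tau> T * g z" for \<tau>
  have le: "val T d l g (y \<tau>) \<tau> \<le> \<phi> \<tau>" if "\<tau> \<in> {0<..<T}" for \<tau>
    using val_le[of \<tau> u "y \<tau>"] that continuous_on_subset[OF u] by (simp add: \<phi>_def y_def)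
  have iu: "integral {t..T} u = integral {t..T} (ctrl d l t \<alpha>)"
    by (intro Henstock_Kurzweil_Integration.integral_cong u_eq)
  have y_t: "y t = x" by (simp add: y_def z_def)
  have "integral {t..T} (\<lambda>s. d t s * l (ctrl d l t \<alpha> s)) = integral {t..T} (\<lambda>s. d t s * l (u s))"
    by (intro Henstock_Kurzweil_Integration.integral_cong) (simp add: u_eq)
  then have eq: "val T d l g (y t) t = \<phi> t"
    unfolding y_t val_eq[OF t0 t(2) \<alpha>] Vfun_eq[OF tT] \<phi>_def z_def iu by simp
  have "(y has_vector_derivative 0 - - u t) (at t)" unfolding y_def[abs_def]
    by (intro has_vector_derivative_diff has_vector_derivative_const tail_integral_derivative[OF u t])
  then have "(y has_derivative (\<lambda>h. h *\<^sub>R \<alpha>)) (at t)"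
    by (simp add: has_vector_derivative_def u_t)
  then have "((\<lambda>\<tau>. (y \<tau>, \<tau>)) has_derivative (\<lambda>h. (h *\<^sub>R \<alpha>, h))) (at t)"
    by (rule has_derivative_Pair) simp
  from has_derivative_compose[OF this, of "\<lambda>(\<xi>, \<tau>). val T d l g \<xi> \<tau>" v'] v' y_t
  have "((\<lambda>\<tau>. val T d l g (y \<tau>) \<tau>) has_derivative (\<lambda>h. v' (h *\<^sub>R \<alpha>, h))) (at t)" by simp
  moreover have "v' (h *\<^sub>R \<alpha>, h) = v' (\<alpha>, 1) * h" for h using v'.scaleR[of h "(\<alpha>, 1)"] by simp
  ultimately have lhs: "((\<lambda>\<tau>. val T d l g (y \<tau>) \<tau>) has_real_derivative v' (\<alpha>, 1)) (at t)"
    by (simp add: has_field_derivative_def)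
  have m: "continuous_on {0..T} (\<lambda>s. l (u s))"
    by (rule continuous_on_compose2[OF continuous_l[of UNIV] u]) auto
  note D = discounted_integral_derivative[OF t m diff, unfolded u_t]
  have "((\<lambda>\<tau>. d \<tau> T) has_real_derivative dt d t T) (at t)"
  proof -
    have at: "at t within {0..T} = at t" using t by (intro at_within_interior) simp
    have "((\<lambda>\<tau>. d \<tau> T) has_vector_derivative dt d t T) (at t within {0..T})"
      unfolding dt_def vector_derivative_works[symmetric] using diff t by simp
    then show ?thesis by (simp add: at has_real_derivative_iff_has_vector_derivative)
  qed
  from DERIV_add[OF D(1) DERIV_cmult_right[OF this, of "g z"]]
  have rhs: "(\<phi> has_real_derivative
      integral {t..T} (\<lambda>s. dt d t s * l (u s)) - l \<alpha> + dt d t T * g z) (at t)"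
    unfolding \<phi>_def[abs_def] by simp
  have "\<forall>\<^sub>F \<tau> in at t. \<tau> \<in> {0<..<T}" using t by (intro eventually_at_in_open') auto
  then have "\<forall>\<^sub>F \<tau> in at t. val T d l g (y \<tau>) \<tau> \<le> \<phi> \<tau>" by eventually_elim (rule le)
  from derivative_eq_of_touching[OF lhs rhs eq this]
  have der: "v' (\<alpha>, 1) = integral {t..T} (\<lambda>s. dt d t s * l (u s)) - l \<alpha> + dt d t T * g z" .
  have "(\<lambda>s. dt d t s * l (ctrl d l t \<alpha> s)) absolutely_integrable_on {t..T}"
    by (rule absolutely_integrable_spike[OF D(2) negligible_empty]) (simp_all add: u_eq)
  then have "(LINT s:{t..T}|lebesgue. dt d t s * l (ctrl d l t \<alpha> s))
      = integral {t..T} (\<lambda>s. dt d t s * l (ctrl d l t \<alpha> s))"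
    by (rule set_lebesgue_integral_eq_integral(2))
  also have "\<dots> = integral {t..T} (\<lambda>s. dt d t s * l (u s))"
    by (intro Henstock_Kurzweil_Integration.integral_cong) (simp add: u_eq)
  finally have w: "wfun T d l g x t \<alpha> = integral {t..T} (\<lambda>s. dt d t s * l (u s)) + dt d t T * g z"
    unfolding wfun_def traj_def
    by (simp add: z_def iu continuous_LINT continuous_ctrl[OF tT sub])
  \<comment> \<open>Linearity removes the transport part, known from the space derivative, and
    isolates the pure time derivative.\<close>
  have "v' (\<alpha>, 1) = v' (\<alpha>, 0) + v' (0, 1)" using v'.add[of "(\<alpha>, 0)" "(0, 1)"] by simp
  then have "v' (0, 1) = wfun T d l g x t \<alpha> - l \<alpha> + grad l \<alpha> \<bullet> \<alpha>"
    using der w space[of \<alpha>] by simp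
  moreover have "legendre l (grad l \<alpha>) = grad l \<alpha> \<bullet> \<alpha> - l \<alpha>" by (simp add: legendre_at)
  ultimately show ?thesis by (simp add: time grad)
qed

end

theorem theorem4p1:
  fixes l g :: "real ^ 'n \<Rightarrow> real"
    and d :: "real \<Rightarrow> real \<Rightarrow> real"
    and T a t :: real
    and x \<alpha> :: "real ^ 'n"
  assumes "T > 0"
    and "C2 l"
    and "strictly_convex l"
    and "filterlim (\<lambda>u. l u / norm u) at_top at_infinity"
    and "\<exists>L. L-lipschitz_on UNIV g"
    and "a > 0"
    and "\<And>t s. t \<in> {0..T} \<Longrightarrow> s \<in> {0..T} \<Longrightarrow> d t s \<in> {a<..1}"
    and "\<exists>L. L-lipschitz_on ({0..T} \<times> {0..T}) (\<lambda>(t, s). d t s)"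
    and "\<And>t. t \<in> {0..T} \<Longrightarrow> d t t = 1"
    and "\<And>t s. 0 \<le> t \<Longrightarrow> t \<le> s \<Longrightarrow> s \<le> T \<Longrightarrow> (\<lambda>\<tau>. d \<tau> s) differentiable (at t within {0..s})"
    and "\<And>s. s \<in> {0..T} \<Longrightarrow> continuous_on {0..s} (\<lambda>t. d t s)"
    and "\<And>s. s \<in> {0..T} \<Longrightarrow> continuous_on {0..s} (\<lambda>t. dt d t s)"
    and "\<And>t. t \<in> {0..T} \<Longrightarrow> set_integrable lebesgue {t..T} (\<lambda>s. d t s)"
    and "\<And>t. t \<in> {0..T} \<Longrightarrow> set_integrable lebesgue {t..T} (\<lambda>s. dt d t s)"
    and "t \<in> {0<..<T}"
    and "(\<lambda>(\<xi>, \<tau>). val T d l g \<xi> \<tau>) differentiable (at (x, t))"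
    and "\<alpha> \<in> Amin T d l g x t"
  shows "- deriv (\<lambda>\<tau>. val T d l g x \<tau>) t
       + legendre l (- grad (\<lambda>\<xi>. val T d l g \<xi> t) x)
       + wfun T d l g x t \<alpha> = 0"
proof -
  interpret discounted_problem l g d T a
    using assms(2-9) by unfold_locales auto
  show ?thesis
    using assms(15) by (intro hamilton_jacobi assms(10,16,17)) auto
qed

end
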